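(* There exists a self-adjoint almost periodic elliptic operator $\mathcal{L}u=(A(x)u')'+c(x)u$ on $\mathbb{R}$ (dimension $N=1$) which is critical but does not admit any positive almost periodic eigenfunction; that is, there are no $\lambda\in\mathbb{R}$ and no positive almost periodic function $\phi$ on $\mathbb{R}$ such that $-\mathcal{L}\phi=\lambda\phi$ on $\mathbb{R}$.
   Context: Here $A,c:\mathbb{R}\to\mathbb{R}$ are measurable and bounded, $A$ is smooth and $\inf_{\mathbb{R}} A>0$. Functions involved in differential equalities or inequalities are understood to be real-valued, to belong to $W^{2,1}_{loc}(\mathbb{R})$, and to satisfy the relation almost everywhere. "Positive" means $>0$ everywhere on $\mathbb{R}$. A function $f:\mathbb{R}\to\mathbb{R}$ is almost periodic if from any sequence $(x_n)_{n\in\mathbb{N}}$ in $\mathbb{R}$ one can extract a subsequence $(x_{n_k})_{k\in\mathbb{N}}$ such that $(f(x+x_{n_k}))_{k\in\mathbb{N}}$ converges uniformly in $x\in\mathbb{R}$. The operator $\mathcal{L}$ is almost periodic if its coefficients $A$ and $c$ are almost periodic functions. The operator $\mathcal{L}$ is critical if the set of positive functions satisfying $\mathcal{L}u\leq 0$ on $\mathbb{R}$ is one-dimensional (that is, it is non-empty and any two of its elements are scalar multiples of one another). *)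

theory Defs
  imports "HOL-Analysis.Analysis"
begin

definition smooth :: "(real \<Rightarrow> real) \<Rightarrow> bool" where
  "smooth f \<longleftrightarrow> (\<forall>n x. ((deriv ^^ n) f) differentiable (at x))"

definition test_function :: "(real \<Rightarrow> real) \<Rightarrow> bool" where
  "test_function \<eta> \<longleftrightarrow> smooth \<eta> \<and> compact (closure {x. \<eta> x \<noteq> 0})"

definition locally_integrable :: "(real \<Rightarrow> real) \<Rightarrow> bool" where
  "locally_integrable f \<longleftrightarrow> (\<forall>K. compact K \<longrightarrow> set_integrable lebesgue K f)"

definition has_weak_deriv :: "(real \<Rightarrow> real) \<Rightarrow> (real \<Rightarrow> real) \<Rightarrow> bool" where
  "has_weak_deriv f g \<longleftrightarrow> locally_integrable f \<and> locally_integrable g \<and>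
     (\<forall>\<eta>. test_function \<eta> \<longrightarrow>
        (LINT x|lebesgue. f x * deriv \<eta> x) = - (LINT x|lebesgue. g x * \<eta> x))"

text \<open>The local Sobolev space of order 2 and exponent 1. Its elements are classes modulo null
  sets, each with exactly one continuous representative; continuity is required here so that
  pointwise positivity and pointwise proportionality of its members make sense.\<close>

definition W21_loc :: "(real \<Rightarrow> real) set" where
  "W21_loc = {u. continuous_on UNIV u \<and> (\<exists>v w. has_weak_deriv u v \<and> has_weak_deriv v w)}"

text \<open>A weak derivative is unique up to null sets. When none exists the value is arbitrary, but
  if \<open>u \<in> W21_loc\<close> and \<open>A\<close> is smooth, both derivatives in \<open>div_op A c u\<close> exist. Its values are
  meaningful only almost everywhere.\<close>

definition weak_deriv :: "(real \<Rightarrow> real) \<Rightarrow> real \<Rightarrow> real" where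
  "weak_deriv f = (SOME g. has_weak_deriv f g)"

definition div_op :: "(real \<Rightarrow> real) \<Rightarrow> (real \<Rightarrow> real) \<Rightarrow> (real \<Rightarrow> real) \<Rightarrow> real \<Rightarrow> real" where
  "div_op A c u = (\<lambda>x. weak_deriv (\<lambda>t. A t * weak_deriv u t) x + c x * u x)"

definition positive_fun :: "(real \<Rightarrow> real) \<Rightarrow> bool" where
  "positive_fun u \<longleftrightarrow> (\<forall>x. u x > 0)"

definition almost_periodic :: "(real \<Rightarrow> real) \<Rightarrow> bool" where
  "almost_periodic f \<longleftrightarrow>
     (\<forall>X :: nat \<Rightarrow> real. \<exists>r g. strict_mono (r :: nat \<Rightarrow> nat) \<and>
        uniform_limit UNIV (\<lambda>k x. f (x + X (r k))) g sequentially)"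

definition positive_supersolutions ::
    "(real \<Rightarrow> real) \<Rightarrow> (real \<Rightarrow> real) \<Rightarrow> (real \<Rightarrow> real) set" where
  "positive_supersolutions A c =
     {u \<in> W21_loc. positive_fun u \<and> (AE x in lebesgue. div_op A c u x \<le> 0)}"

definition critical :: "(real \<Rightarrow> real) \<Rightarrow> (real \<Rightarrow> real) \<Rightarrow> bool" where
  "critical A c \<longleftrightarrow> positive_supersolutions A c \<noteq> {} \<and>
     (\<forall>u \<in> positive_supersolutions A c. \<forall>v \<in> positive_supersolutions A c.
        \<exists>k. \<forall>x. v x = k * u x)"

end

theory Submission
  imports Defs "HOL-Complex_Analysis.Great_Picard"
begin

text \<open>Take \<open>A = 1\<close> and \<open>c = - u'' / u\<close> with \<open>u = exp W\<close>, \<open>W x = (\<Sum>n. 1 - cos (x / 2^n))\<close>. The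
  derivatives \<open>W'\<close>, \<open>W''\<close> are uniform limits of trigonometric polynomials, so \<open>c = - (W'' + W'^2)\<close> is
  almost periodic. From \<open>W (2 x) = W x + 1 - cos (2 x)\<close>, \<open>W\<close> keeps the same value along \<open>2^m * 2 * pi\<close>,
  hence the integral of \<open>u^(-2)\<close> diverges at both ends, while \<open>W\<close> grows along \<open>2^m * 2 * pi / 3\<close>,
  hence the even function \<open>u\<close> is unbounded on both half-lines.

  If \<open>v\<close> is a supersolution then \<open>v / u\<close> is a concave function of \<open>s\<close>, the antiderivative of \<open>u^(-2)\<close>,
  because \<open>(u^2 (v / u)')' = u (v'' + c v)\<close>. As \<open>s\<close> covers the real line, a positive such \<open>v / u\<close>
  is constant: this is criticality. A positive eigenfunction with \<open>\<lambda> \<ge> 0\<close> is a supersolution, so a multiple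
  of \<open>u\<close>; with \<open>\<lambda> \<le> 0\<close> its quotient by \<open>u\<close> is convex in \<open>s\<close>, so bounded below by a positive
  constant on a half-line. Either way it is unbounded, whereas almost periodic functions are bounded.\<close>

section \<open>Smooth bump functions\<close>

primrec ndiff :: "nat \<Rightarrow> (real \<Rightarrow> real) \<Rightarrow> bool" where
  "ndiff 0 f \<longleftrightarrow> True"
| "ndiff (Suc n) f \<longleftrightarrow> (\<forall>x. f differentiable (at x)) \<and> ndiff n (deriv f)"

text \<open>\<open>ndiff\<close> strips the innermost derivative, so closure properties follow by
  induction on the order with the function left general; \<open>funpow_Suc_right\<close> reconciles
  this with the iterates in \<open>smooth\<close>.\<close>

lemma ndiff_iff: "ndiff n f \<longleftrightarrow> (\<forall>m<n. \<forall>x. (deriv ^^ m) f differentiable (at x))"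
proof (induction n arbitrary: f)
  case (Suc n)
  have "(\<forall>m<Suc n. P m) \<longleftrightarrow> P 0 \<and> (\<forall>m<n. P (Suc m))" for P
    using less_Suc_eq_0_disj by auto
  then show ?case
    using Suc by (simp add: funpow_Suc_right del: funpow.simps)
qed simp

lemma smooth_iff_ndiff: "smooth f \<longleftrightarrow> (\<forall>n. ndiff n f)"
  unfolding smooth_def ndiff_iff by blast

lemma ndiff_SucI:
  assumes "\<And>x. (f has_real_derivative f' x) (at x)" "ndiff n f'"
  shows "ndiff (Suc n) f"
proof -
  have "deriv f = f'"
    using assms(1) DERIV_imp_deriv by blast
  then show ?thesis
    using assms real_differentiable_def by auto
qed

lemma ndiff_SucD:
  assumes "ndiff (Suc n) f"
  shows "(f has_real_derivative deriv f x) (at x)" "ndiff n (deriv f)"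
  using assms DERIV_deriv_iff_real_differentiable by auto

lemma ndiff_mono_Suc: "ndiff (Suc n) f \<Longrightarrow> ndiff n f"
  by (auto simp: ndiff_iff)

lemma ndiff_const: "ndiff n (\<lambda>x. c)"
proof (induction n arbitrary: c)
  case (Suc n)
  show ?case
    by (rule ndiff_SucI[where f' = "\<lambda>x. 0"]) (auto intro: Suc)
qed simp

lemma ndiff_add: "ndiff n f \<Longrightarrow> ndiff n g \<Longrightarrow> ndiff n (\<lambda>x. f x + g x)"
proof (induction n arbitrary: f g)
  case (Suc n)
  show ?case
  proof (rule ndiff_SucI)
    show "((\<lambda>x. f x + g x) has_real_derivative deriv f x + deriv g x) (at x)" for x
      by (rule DERIV_add[OF ndiff_SucD(1)[OF Suc.prems(1)] ndiff_SucD(1)[OF Suc.prems(2)]])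
    show "ndiff n (\<lambda>x. deriv f x + deriv g x)"
      by (rule Suc.IH[OF ndiff_SucD(2)[OF Suc.prems(1)] ndiff_SucD(2)[OF Suc.prems(2)]])
  qed
qed simp

lemma ndiff_mult: "ndiff n f \<Longrightarrow> ndiff n g \<Longrightarrow> ndiff n (\<lambda>x. f x * g x)"
proof (induction n arbitrary: f g)
  case (Suc n)
  note D = ndiff_SucD[OF Suc.prems(1)] ndiff_SucD[OF Suc.prems(2)]
  show ?case
  proof (rule ndiff_SucI)
    show "((\<lambda>x. f x * g x) has_real_derivative deriv f x * g x + deriv g x * f x) (at x)" for x
      by (rule DERIV_mult[OF D(1) D(3)])
    show "ndiff n (\<lambda>x. deriv f x * g x + deriv g x * f x)"
      \<comment> \<open>Each summand of the product rule keeps one factor undifferentiated, so the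
        order of that factor is lowered by one to fit the induction hypothesis.\<close>
      by (rule ndiff_add[OF Suc.IH[OF D(2) ndiff_mono_Suc[OF Suc.prems(2)]]
            Suc.IH[OF D(4) ndiff_mono_Suc[OF Suc.prems(1)]]])
  qed
qed simp

lemma ndiff_affine: "ndiff n f \<Longrightarrow> ndiff n (\<lambda>x. f (a * x + b))"
proof (induction n arbitrary: f)
  case (Suc n)
  note D = ndiff_SucD[OF Suc.prems]
  show ?case
  proof (rule ndiff_SucI)
    show "((\<lambda>x. f (a * x + b)) has_real_derivative deriv f (a * x + b) * a) (at x)" for x
      by (rule DERIV_chain2[OF D(1)]) (auto intro!: derivative_eq_intros)
    show "ndiff n (\<lambda>x. deriv f (a * x + b) * a)"
      by (rule ndiff_mult[OF Suc.IH[OF D(2)] ndiff_const])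
  qed
qed simp

lemma smooth_const: "smooth (\<lambda>x. c)"
  and smooth_mult: "smooth f \<Longrightarrow> smooth g \<Longrightarrow> smooth (\<lambda>x. f x * g x)"
  and smooth_affine: "smooth f \<Longrightarrow> smooth (\<lambda>x. f (a * x + b))"
  by (simp_all add: smooth_iff_ndiff ndiff_const ndiff_mult ndiff_affine)

lemma smooth_DERIV: "smooth f \<Longrightarrow> (f has_real_derivative deriv f x) (at x)"
  using ndiff_SucD(1) smooth_iff_ndiff by blast

lemma smooth_deriv: "smooth f \<Longrightarrow> smooth (deriv f)"
  using ndiff_SucD(2) smooth_iff_ndiff by blast

lemma smooth_continuous_on: "smooth f \<Longrightarrow> continuous_on S f"
  using smooth_DERIV DERIV_continuous_on has_field_derivative_at_within by metis

text \<open>The powers of \<open>1 / x\<close> make the span of this family closed under differentiation.\<close>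

definition flat_exp :: "nat \<Rightarrow> real \<Rightarrow> real" where
  "flat_exp k x = (if x > 0 then (1 / x) ^ k * exp (- (1 / x)) else 0)"

lemma flat_exp_DERIV:
  "(flat_exp k has_real_derivative flat_exp (k + 2) x - real k * flat_exp (k + 1) x) (at x)"
proof -
  consider "x > 0" | "x < 0" | "x = 0" by linarith
  then show ?thesis
  proof cases
    case 1
    have "((\<lambda>x. (1 / x) ^ k * exp (- (1 / x))) has_real_derivative
        real k * (1 / x) ^ (k - 1) * (- ((1 / x) ^ 2)) * exp (- (1 / x)) +
        exp (- (1 / x)) * (1 / x) ^ 2 * (1 / x) ^ k) (at x)"
      using 1 by (auto intro!: derivative_eq_intros simp: power2_eq_square)
    also have "real k * (1 / x) ^ (k - 1) * (- ((1 / x) ^ 2)) * exp (- (1 / x)) +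
        exp (- (1 / x)) * (1 / x) ^ 2 * (1 / x) ^ k =
        flat_exp (k + 2) x - real k * flat_exp (k + 1) x"
      using 1 by (cases k) (simp_all add: flat_exp_def power_add power2_eq_square algebra_simps add_divide_distrib)
    finally have "((\<lambda>x. (1 / x) ^ k * exp (- (1 / x))) has_real_derivative
        flat_exp (k + 2) x - real k * flat_exp (k + 1) x) (at x)" .
    then show ?thesis
      by (rule has_field_derivative_transform_within_open[where S = "{0<..}"])
        (use 1 in \<open>auto simp: flat_exp_def\<close>)
  next
    case 2
    have "((\<lambda>x. 0) has_real_derivative flat_exp (k + 2) x - real k * flat_exp (k + 1) x) (at x)"
      using 2 by (auto simp: flat_exp_def)
    then show ?thesis
      by (rule has_field_derivative_transform_within_open[where S = "{..<0}"])
        (use 2 in \<open>auto simp: flat_exp_def\<close>)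
  next
    case 3
    \<comment> \<open>With \<open>t = 1 / h\<close>, the difference quotient at 0 from the right is
      \<open>t ^ Suc k / exp t\<close>, and the exponential beats every power. From the left it is
      identically 0.\<close>
    have "((\<lambda>t. t ^ Suc k / exp t) \<longlongrightarrow> (0::real)) at_top"
      by (rule tendsto_power_div_exp_0)
    then have "((\<lambda>x. (inverse x) ^ Suc k / exp (inverse x)) \<longlongrightarrow> (0::real)) (at_right 0)"
      by (rule filterlim_compose[OF _ filterlim_inverse_at_top_right])
    then have R: "((\<lambda>h. flat_exp k h / h) \<longlongrightarrow> 0) (at_right 0)"
      by (rule Lim_transform_eventually)
        (auto simp: eventually_at_filter flat_exp_def exp_minus field_simps)
    have L: "((\<lambda>h. flat_exp k h / h) \<longlongrightarrow> 0) (at_left 0)"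
      by (rule Lim_transform_eventually[OF tendsto_const])
        (auto simp: eventually_at_filter flat_exp_def)
    have "((\<lambda>h. flat_exp k h / h) \<longlongrightarrow> 0) (at 0)"
      using R L filterlim_split_at by blast
    then show ?thesis
      using 3 by (simp add: DERIV_def flat_exp_def)
  qed
qed

lemma ndiff_flat_exp: "ndiff n (flat_exp k)"
proof (induction n arbitrary: k)
  case (Suc n)
  have "ndiff n (\<lambda>x. flat_exp (k + 2) x + (- real k) * flat_exp (k + 1) x)"
    by (intro ndiff_add ndiff_mult ndiff_const Suc)
  then show ?case
    by (intro ndiff_SucI[OF flat_exp_DERIV]) simp
qed simp

lemma smooth_flat_exp: "smooth (flat_exp k)"
  by (simp add: smooth_iff_ndiff ndiff_flat_exp)

text \<open>The factor \<open>n\<close> sharpens the edges: the bumps tend to the indicator of the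
  open interval as \<open>n\<close> grows. The same family with \<open>n = 1\<close> supplies the
  mollifier.\<close>

definition bump :: "real \<Rightarrow> real \<Rightarrow> real \<Rightarrow> real \<Rightarrow> real" where
  "bump n a b x = flat_exp 0 (n * (x - a)) * flat_exp 0 (n * (b - x))"

lemma bump_nonneg: "0 \<le> bump n a b x"
  and bump_le_1: "bump n a b x \<le> 1"
proof -
  have *: "0 \<le> flat_exp 0 y" "flat_exp 0 y \<le> 1" for y
    by (auto simp: flat_exp_def)
  show "0 \<le> bump n a b x" "bump n a b x \<le> 1"
    unfolding bump_def using * by (auto intro: mult_le_one)
qed

lemma bump_pos_iff: "n > 0 \<Longrightarrow> bump n a b x > 0 \<longleftrightarrow> a < x \<and> x < b"
  and bump_eq_0: "n > 0 \<Longrightarrow> \<not> (a < x \<and> x < b) \<Longrightarrow> bump n a b x = 0"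
  by (auto simp: bump_def flat_exp_def zero_less_mult_iff)

lemma smooth_bump: "smooth (bump n a b)"
proof -
  have "smooth (\<lambda>x. flat_exp 0 (n * x + (- n * a)) * flat_exp 0 ((- n) * x + n * b))"
    by (intro smooth_mult smooth_affine smooth_flat_exp)
  then show ?thesis
    by (simp add: bump_def[abs_def] algebra_simps)
qed

section \<open>Test functions and their supports\<close>

lemma test_functionI:
  assumes "smooth f" "\<And>x. x < a \<or> x > b \<Longrightarrow> f x = 0"
  shows "test_function f"
proof -
  have "closure {x. f x \<noteq> 0} \<subseteq> {a..b}"
    using assms(2) by (intro closure_minimal) (auto simp: not_less[symmetric])
  then have "compact (closure {x. f x \<noteq> 0})"
    by (meson bounded_closed_interval bounded_subset closed_closure compact_eq_bounded_closed)
  then show ?thesis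
    using assms(1) by (simp add: test_function_def)
qed

lemma test_function_bound:
  assumes "test_function f"
  obtains R where "R > 0" "\<And>x. \<bar>x\<bar> > R \<Longrightarrow> f x = 0"
proof -
  have "bounded {x. f x \<noteq> 0}"
    using assms bounded_subset closure_subset compact_imp_bounded unfolding test_function_def by metis
  then obtain R where "R > 0" "\<And>x. f x \<noteq> 0 \<Longrightarrow> norm x \<le> R"
    unfolding bounded_pos by blast
  then show ?thesis
    using that by force
qed

lemma test_function_deriv:
  assumes "test_function f"
  shows "test_function (deriv f)"
proof -
  obtain R where R: "\<And>x. \<bar>x\<bar> > R \<Longrightarrow> f x = 0"
    using test_function_bound[OF assms] by metis
  have "deriv f x = 0" if x: "x < -R \<or> x > R" for x
  proof -
    have "((\<lambda>x. 0) has_real_derivative 0) (at x)" by simp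
    then have "(f has_real_derivative 0) (at x)"
      by (rule has_field_derivative_transform_within_open[where S = "{..< -R} \<union> {R<..}"])
        (use x R in auto)
    then show ?thesis by (rule DERIV_imp_deriv)
  qed
  then show ?thesis
    using assms smooth_deriv by (intro test_functionI) (auto simp: test_function_def)
qed

lemma test_function_bump: "n > 0 \<Longrightarrow> test_function (bump n a b)"
  by (rule test_functionI[OF smooth_bump, of a b]) (auto intro!: bump_eq_0)

section \<open>Weak derivatives\<close>

lemma locally_integrable_continuous:
  assumes "continuous_on UNIV f"
  shows "locally_integrable f"
  unfolding locally_integrable_def
proof (intro allI impI)
  fix K :: "real set"
  assume K: "compact K"
  then have "bounded K"
    by (rule compact_imp_bounded)
  then obtain R where "\<And>x. x \<in> K \<Longrightarrow> norm x \<le> R"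
    using bounded_iff by metis
  then have "K \<subseteq> {-R..R}" by force
  moreover have "set_integrable lebesgue {-R..R} f"
    using assms absolutely_integrable_continuous_real continuous_on_subset by blast
  moreover have "K \<in> sets lebesgue"
    using K by (simp add: borel_compact sets_completionI_sets)
  ultimately show "set_integrable lebesgue K f"
    using set_integrable_subset by blast
qed

lemma set_integrable_open_interval:
  assumes "locally_integrable g"
  shows "set_integrable lebesgue {a<..<b} g"
proof (rule set_integrable_subset)
  show "set_integrable lebesgue {a..b} g"
    using assms compact_Icc unfolding locally_integrable_def by blast
qed auto

text \<open>On \<open>{-R..R}\<close> the continuous factor is bounded, so the product is dominated
  by a multiple of \<open>g\<close> cut off to that interval.\<close>

lemma integrable_mult_compact_support:
  assumes g: "locally_integrable g"
    and h: "continuous_on UNIV h" "\<And>x. \<bar>x\<bar> > R \<Longrightarrow> h x = 0"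
  shows "integrable lebesgue (\<lambda>x. g x * h x)"
proof -
  have G: "integrable lebesgue (\<lambda>x. indicator {-R..R} x * g x)"
    using g unfolding locally_integrable_def set_integrable_def by simp
  have "bounded (h ` {-R..R})"
    by (intro compact_imp_bounded compact_continuous_image continuous_on_subset[OF h(1)]) auto
  then obtain B where B: "\<And>x. x \<in> {-R..R} \<Longrightarrow> norm (h x) \<le> B"
    unfolding bounded_iff by blast
  have "h \<in> borel_measurable borel"
    using h(1) borel_measurable_continuous_onI by blast
  then have hm: "h \<in> borel_measurable lebesgue"
    by (intro measurable_completion) simp
  have eq: "g x * h x = (indicator {-R..R} x * g x) * h x" for x
    using h(2)[of x] by (cases "\<bar>x\<bar> > R") (auto simp: indicator_def)
  show ?thesis
    unfolding eq
  proof (rule Bochner_Integration.integrable_bound)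
    show "integrable lebesgue (\<lambda>x. B * (indicator {-R..R} x * g x))"
      using G by simp
    show "(\<lambda>x. indicator {-R..R} x * g x * h x) \<in> borel_measurable lebesgue"
      using borel_measurable_integrable[OF G] hm by measurable
    show "AE x in lebesgue. norm (indicator {-R..R} x * g x * h x)
        \<le> norm (B * (indicator {-R..R} x * g x))"
    proof (rule AE_I2)
      fix x
      show "norm (indicator {-R..R} x * g x * h x) \<le> norm (B * (indicator {-R..R} x * g x))"
      proof (cases "x \<in> {-R..R}")
        case True
        then have "\<bar>h x\<bar> \<le> \<bar>B\<bar>"
          using B[OF True] by auto
        then have "\<bar>g x\<bar> * \<bar>h x\<bar> \<le> \<bar>g x\<bar> * \<bar>B\<bar>"
          by (intro mult_left_mono) auto
        then show ?thesis
          using True by (simp add: abs_mult mult.commute)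
      qed simp
    qed
  qed
qed

lemma integrable_mult_test_function:
  assumes "locally_integrable g" "test_function \<eta>"
  shows "integrable lebesgue (\<lambda>x. g x * \<eta> x)"
proof -
  obtain R where "\<And>x. \<bar>x\<bar> > R \<Longrightarrow> \<eta> x = 0"
    using test_function_bound[OF assms(2)] by metis
  then show ?thesis
    using integrable_mult_compact_support assms smooth_continuous_on test_function_def by blast
qed

text \<open>Integration by parts: the derivative of \<open>f * \<eta>\<close> integrates to 0
  because \<open>\<eta>\<close> has compact support.\<close>

lemma has_weak_deriv_C1:
  assumes f: "\<And>x. (f has_real_derivative f' x) (at x)" and f': "continuous_on UNIV f'"
  shows "has_weak_deriv f f'"
  unfolding has_weak_deriv_def
proof (intro conjI allI impI)
  have cf: "continuous_on UNIV f"
    using f DERIV_continuous_on by blast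
  show lf: "locally_integrable f" and lf': "locally_integrable f'"
    using locally_integrable_continuous cf f' by auto
  fix \<eta>
  assume \<eta>: "test_function \<eta>"
  obtain R where R: "R > 0" "\<And>x. \<bar>x\<bar> > R \<Longrightarrow> \<eta> x = 0"
    using test_function_bound[OF \<eta>] by metis
  have \<eta>': "test_function (deriv \<eta>)"
    using \<eta> by (rule test_function_deriv)
  have i1: "integrable lebesgue (\<lambda>x. f x * deriv \<eta> x)"
    and i2: "integrable lebesgue (\<lambda>x. f' x * \<eta> x)"
    using integrable_mult_test_function lf lf' \<eta> \<eta>' by auto
  have D: "((\<lambda>x. f x * \<eta> x) has_real_derivative f' x * \<eta> x + f x * deriv \<eta> x) (at x)" for x
    using DERIV_mult[OF f smooth_DERIV, of \<eta> x] \<eta> by (simp add: test_function_def mult.commute)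
  \<comment> \<open>The bound \<open>R\<close> makes \<open>\<eta>\<close> vanish only strictly
    beyond \<open>R\<close>; enlarging it by 1 kills the boundary terms.\<close>
  have "((\<lambda>x. f' x * \<eta> x + f x * deriv \<eta> x) has_integral
      f (R + 1) * \<eta> (R + 1) - f (- (R + 1)) * \<eta> (- (R + 1))) {- (R + 1)..R + 1}"
    using R(1) D
    by (intro fundamental_theorem_of_calculus)
      (auto simp: has_real_derivative_iff_has_vector_derivative has_vector_derivative_at_within)
  then have "((\<lambda>x. f' x * \<eta> x + f x * deriv \<eta> x) has_integral 0) {- (R + 1)..R + 1}"
    using R by simp
  moreover have "f' x * \<eta> x + f x * deriv \<eta> x = 0" if "x \<notin> {- (R + 1)..R + 1}" for x
  proof -
    have "((\<lambda>x. 0) has_real_derivative 0) (at x)" by simp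
    then have "(\<eta> has_real_derivative 0) (at x)"
      by (rule has_field_derivative_transform_within_open[where S = "{..< -R} \<union> {R<..}"])
        (use that R in auto)
    then have "deriv \<eta> x = 0" by (rule DERIV_imp_deriv)
    moreover have "\<eta> x = 0" using that R by auto
    ultimately show ?thesis by simp
  qed
  ultimately have "((\<lambda>x. f' x * \<eta> x + f x * deriv \<eta> x) has_integral 0) UNIV"
    by (rule has_integral_on_superset) (assumption, rule subset_UNIV)
  moreover have "((\<lambda>x. f' x * \<eta> x + f x * deriv \<eta> x) has_integral
      (LINT x|lebesgue. f' x * \<eta> x + f x * deriv \<eta> x)) UNIV"
    using i1 i2 by (intro has_integral_integral_lebesgue) auto
  ultimately have "(LINT x|lebesgue. f' x * \<eta> x + f x * deriv \<eta> x) = 0"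
    by (rule has_integral_unique[rotated])
  then show "(LINT x|lebesgue. f x * deriv \<eta> x) = - (LINT x|lebesgue. f' x * \<eta> x)"
    using i1 i2 by simp
qed

lemma has_weak_deriv_weak_deriv:
  assumes "has_weak_deriv f g"
  shows "has_weak_deriv f (weak_deriv f)"
  unfolding weak_deriv_def using assms by (rule someI[of "has_weak_deriv f" g])

text \<open>The chosen \<open>weak_deriv u\<close> may differ from the witness \<open>v\<close>, but
  both pair equally with derivatives of test functions, so \<open>w\<close> is a weak derivative of
  either. Two integrations by parts restore the plus sign.\<close>

lemma W21_loc_second_weak_deriv:
  assumes "u \<in> W21_loc"
  shows "locally_integrable (weak_deriv (weak_deriv u))"
    and "test_function \<eta> \<Longrightarrow>
      (LINT x|lebesgue. u x * deriv (deriv \<eta>) x) = (LINT x|lebesgue. weak_deriv (weak_deriv u) x * \<eta> x)"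
proof -
  obtain v w where v: "has_weak_deriv u v" and w: "has_weak_deriv v w"
    using assms unfolding W21_loc_def by blast
  have 1: "has_weak_deriv u (weak_deriv u)"
    using v by (rule has_weak_deriv_weak_deriv)
  have "has_weak_deriv (weak_deriv u) w"
    unfolding has_weak_deriv_def
  proof (intro conjI allI impI)
    show "locally_integrable (weak_deriv u)" "locally_integrable w"
      using 1 w by (simp_all add: has_weak_deriv_def)
    fix \<eta>
    assume \<eta>: "test_function \<eta>"
    have "(LINT x|lebesgue. weak_deriv u x * deriv \<eta> x) = (LINT x|lebesgue. v x * deriv \<eta> x)"
      using 1 v test_function_deriv[OF \<eta>] by (simp add: has_weak_deriv_def)
    then show "(LINT x|lebesgue. weak_deriv u x * deriv \<eta> x) = - (LINT x|lebesgue. w x * \<eta> x)"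
      using w \<eta> by (simp add: has_weak_deriv_def)
  qed
  then have 2: "has_weak_deriv (weak_deriv u) (weak_deriv (weak_deriv u))"
    by (rule has_weak_deriv_weak_deriv)
  show "locally_integrable (weak_deriv (weak_deriv u))"
    using 2 by (simp add: has_weak_deriv_def)
  show "(LINT x|lebesgue. u x * deriv (deriv \<eta>) x) = (LINT x|lebesgue. weak_deriv (weak_deriv u) x * \<eta> x)"
    if "test_function \<eta>"
    using 1 2 test_function_deriv[OF that] that unfolding has_weak_deriv_def by simp
qed

section \<open>The fundamental lemma of the calculus of variations\<close>

lemma bump_tendsto_indicator:
  "(\<lambda>n. bump (real (Suc n)) a b x) \<longlonglongrightarrow> indicator {a<..<b} x"
proof (cases "a < x \<and> x < b")
  case True
  have *: "(\<lambda>n. flat_exp 0 (real (Suc n) * y)) \<longlonglongrightarrow> 1" if "y > 0" for y :: real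
  proof -
    have "(\<lambda>n. exp (- (inverse (real (Suc n)) * (1 / y)))) \<longlonglongrightarrow> exp (- (0 * (1 / y)))"
      by (intro tendsto_intros LIMSEQ_inverse_real_of_nat)
    moreover have "flat_exp 0 (real (Suc n) * y) = exp (- (inverse (real (Suc n)) * (1 / y)))" for n
      using that by (simp add: flat_exp_def field_simps del: of_nat_Suc)
    ultimately show ?thesis
      by simp
  qed
  have "(\<lambda>n. bump (real (Suc n)) a b x) \<longlonglongrightarrow> 1 * 1"
    unfolding bump_def using True by (intro tendsto_mult *) auto
  then show ?thesis
    using True by simp
next
  case False
  then show ?thesis
    by (auto simp: bump_eq_0 simp del: of_nat_Suc)
qed

text \<open>The indicator is a limit of sharpening bumps, and the products with \<open>g\<close> are
  dominated by \<open>\<bar>g\<bar>\<close> on the closed interval.\<close>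

lemma integral_interval_eq_0:
  assumes g: "locally_integrable g"
    and 0: "\<And>\<eta>. test_function \<eta> \<Longrightarrow> (LINT x|lebesgue. g x * \<eta> x) = 0"
  shows "(LINT x|lebesgue. g x * indicator {a<..<b} x) = 0"
proof -
  have G: "integrable lebesgue (\<lambda>x. indicator {a..b} x * g x)"
    using g unfolding locally_integrable_def set_integrable_def by simp
  have "set_integrable lebesgue {a<..<b} g"
    using g by (rule set_integrable_open_interval)
  then have G': "integrable lebesgue (\<lambda>x. g x * indicator {a<..<b} x)"
    unfolding set_integrable_def by (simp add: mult.commute)
  have t: "test_function (bump (real (Suc n)) a b)" for n
    by (simp add: test_function_bump)
  have "(\<lambda>n. LINT x|lebesgue. g x * bump (real (Suc n)) a b x) \<longlonglongrightarrow>
      (LINT x|lebesgue. g x * indicator {a<..<b} x)"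
  proof (rule integral_dominated_convergence)
    show "integrable lebesgue (\<lambda>x. norm (indicator {a..b} x * g x))"
      using G by (rule integrable_norm)
    show "(\<lambda>x. g x * indicator {a<..<b} x) \<in> borel_measurable lebesgue"
      using G' by (rule borel_measurable_integrable)
    show "(\<lambda>x. g x * bump (real (Suc n)) a b x) \<in> borel_measurable lebesgue" for n
      using integrable_mult_test_function[OF g t] by (rule borel_measurable_integrable)
    show "AE x in lebesgue. (\<lambda>n. g x * bump (real (Suc n)) a b x) \<longlonglongrightarrow> g x * indicator {a<..<b} x"
      by (intro AE_I2 tendsto_mult tendsto_const bump_tendsto_indicator)
    show "AE x in lebesgue. norm (g x * bump (real (Suc n)) a b x) \<le> norm (indicator {a..b} x * g x)" for n
    proof (rule AE_I2)
      fix x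
      show "norm (g x * bump (real (Suc n)) a b x) \<le> norm (indicator {a..b} x * g x)"
      proof (cases "a < x \<and> x < b")
        case True
        then show ?thesis
          using bump_nonneg bump_le_1 by (simp add: abs_mult mult_left_le)
      next
        case False
        then show ?thesis
          by (simp add: bump_eq_0 del: of_nat_Suc)
      qed
    qed
  qed
  then show ?thesis
    unfolding 0[OF t] by (simp add: LIMSEQ_const_iff)
qed

text \<open>Open intervals form an intersection-stable generator of the Borel sets. Sets on which
  the integral vanishes are closed under complements, thanks to \<open>univ\<close>, and under
  countable disjoint unions.\<close>

lemma integral_borel_eq_0:
  fixes f :: "real \<Rightarrow> real"
  assumes f: "integrable lebesgue f"
    and univ: "(LINT x|lebesgue. f x) = 0"
    and 0: "\<And>a b. (LINT x|lebesgue. f x * indicator {a<..<b} x) = 0"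
    and A: "A \<in> sets borel"
  shows "(LINT x|lebesgue. f x * indicator A x) = 0"
proof -
  let ?G = "range (\<lambda>(a, b). box a b :: real set)"
  have leb: "B \<in> sets lebesgue" if "B \<in> sigma_sets UNIV ?G" for B
    using that sets_completionI_sets[of B lborel] by (simp add: borel_eq_box sets_measure_of del: box_real)
  have "Int_stable ?G"
  proof (rule Int_stableI_image)
    fix p q :: "real \<times> real"
    show "\<exists>r\<in>UNIV. (case p of (a, b) \<Rightarrow> box a b) \<inter> (case q of (a, b) \<Rightarrow> box a b)
        = (case r of (a, b) \<Rightarrow> box a b)"
      by (rule bexI[of _ "(max (fst p) (fst q), min (snd p) (snd q))"])
        (auto simp: box_real split_beta)
  qed
  moreover have "?G \<subseteq> Pow UNIV" by auto
  moreover have "A \<in> sigma_sets UNIV ?G"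
    using A unfolding borel_eq_box by (simp add: sets_measure_of del: box_real)
  ultimately show ?thesis
  proof (induction rule: sigma_sets_induct_disjoint)
    case (basic A)
    then show ?case using 0 by (auto simp: box_real)
  next
    case empty
    then show ?case by simp
  next
    case (compl A)
    have "A \<in> sets lebesgue"
      using compl(1) leb by blast
    then have i: "integrable lebesgue (\<lambda>x. f x * indicator A x)"
      using f by (intro integrable_real_mult_indicator)
    have "f x * indicator (UNIV - A) x = f x - f x * indicator A x" for x
      by (simp add: indicator_def)
    then show ?case
      using f i compl(2) univ by simp
  next
    case (union B)
    have B: "B i \<in> sets lebesgue" for i
      using union(2) leb by blast
    have "set_integrable lebesgue (\<Union>i. B i) f"
      unfolding set_integrable_def using integrable_real_mult_indicator[OF _ f] B
      by (simp add: mult.commute sets.countable_UN)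
    then have "(LINT x:(\<Union>i. B i)|lebesgue. f x) = (\<Sum>i. (LINT x:(B i)|lebesgue. f x))"
      using B union(1)
      by (intro lebesgue_integral_countable_add) (auto simp: disjoint_family_on_def)
    then show ?case
      using union(3) by (simp add: set_lebesgue_integral_def mult.commute)
  qed
qed

text \<open>The argument runs on the windows \<open>{- real n<..<real n}\<close>, where
  \<open>g\<close> is integrable; countably many almost-everywhere statements then combine into
  one.\<close>

lemma fundamental_lemma_of_variations:
  assumes g: "locally_integrable g"
    and 0: "\<And>\<eta>. test_function \<eta> \<Longrightarrow> (LINT x|lebesgue. g x * \<eta> x) = 0"
  shows "AE x in lebesgue. g x = 0"
proof -
  have "AE x in lebesgue. g x * indicator {- real n<..<real n} x = 0" for n
  proof -
    let ?f = "\<lambda>x. g x * indicator {- real n<..<real n} x"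
    have "set_integrable lebesgue {- real n<..<real n} g"
      using g by (rule set_integrable_open_interval)
    then have f: "integrable lebesgue ?f"
      unfolding set_integrable_def by (simp add: mult.commute)
    have Z: "(LINT x|lebesgue. ?f x * indicator A x) = 0" if A: "A \<in> sets lebesgue" for A
    proof -
      \<comment> \<open>A Lebesgue set is a Borel set up to a null set, so the vanishing of the
        integral extends from Borel sets.\<close>
      obtain S N N' where A': "A = S \<union> N" "N \<subseteq> N'" "N' \<in> null_sets lborel" "S \<in> sets borel"
        using A by (elim sets_completionE) auto
      have "(LINT x|lebesgue. ?f x * indicator S x) = 0"
      proof (rule integral_borel_eq_0[OF f _ _ A'(4)])
        show "(LINT x|lebesgue. ?f x) = 0"
          using integral_interval_eq_0[OF g 0] .
        show "(LINT x|lebesgue. ?f x * indicator {a<..<b} x) = 0" for a b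
        proof -
          have "?f x * indicator {a<..<b} x = g x * indicator {max (- real n) a<..<min (real n) b} x" for x
            by (auto simp: indicator_def)
          then show ?thesis
            using integral_interval_eq_0[OF g 0] by (simp only:)
        qed
      qed
      moreover have "(LINT x|lebesgue. ?f x * indicator S x) = (LINT x|lebesgue. ?f x * indicator A x)"
      proof (rule integral_cong_AE)
        have "S \<in> sets lebesgue"
          using A'(4) by (intro sets_completionI_sets) simp
        then show "(\<lambda>x. ?f x * indicator S x) \<in> borel_measurable lebesgue"
          "(\<lambda>x. ?f x * indicator A x) \<in> borel_measurable lebesgue"
          using integrable_real_mult_indicator[OF _ f] A by (auto intro!: borel_measurable_integrable)
        have "AE x in lebesgue. x \<notin> N'"
          using A'(3) by (intro AE_completion AE_not_in)
        then show "AE x in lebesgue. ?f x * indicator S x = ?f x * indicator A x"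
          by eventually_elim (use A'(1,2) in \<open>auto simp: indicator_def\<close>)
      qed
      ultimately show ?thesis by simp
    qed
    have fm: "?f \<in> borel_measurable lebesgue"
      using f by (rule borel_measurable_integrable)
    \<comment> \<open>Integrating over the sets where \<open>?f\<close> is positive and where it is
      negative gives two integrands of constant sign with integral 0.\<close>
    have P: "{x. ?f x > 0} \<in> sets lebesgue" and M: "{x. ?f x < 0} \<in> sets lebesgue"
      using borel_measurable_less[OF borel_measurable_const fm, of 0]
        borel_measurable_less[OF fm borel_measurable_const, of 0] by simp_all
    have "AE x in lebesgue. ?f x * indicator {x. ?f x > 0} x = 0"
      using Z[OF P] integral_nonneg_eq_0_iff_AE[OF integrable_real_mult_indicator[OF P f]]
      by (auto simp: indicator_def)
    moreover have "AE x in lebesgue. - (?f x * indicator {x. ?f x < 0} x) = 0"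
      using Z[OF M] integral_nonneg_eq_0_iff_AE[OF
          Bochner_Integration.integrable_minus[OF integrable_real_mult_indicator[OF M f]]]
      by (auto simp: indicator_def)
    ultimately show ?thesis
      by eventually_elim (auto simp: indicator_def split: if_splits)
  qed
  then have "AE x in lebesgue. \<forall>n. g x * indicator {- real n<..<real n} x = 0"
    by (rule AE_all_countable[THEN iffD2, rule_format])
  then show ?thesis
  proof eventually_elim
    case (elim x)
    obtain n where "\<bar>x\<bar> < real n"
      using reals_Archimedean2 by blast
    then show ?case
      using elim[rule_format, of n] by (auto simp: indicator_def split: if_splits)
  qed
qed

section \<open>Concavity of supersolutions relative to a positive solution\<close>

text \<open>Passing to a gauge integral over a fixed compact interval makes the Leibniz rule for
  parameter integrals applicable.\<close>

lemma lebesgue_integral_eq_integral_cbox: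
  fixes h :: "real \<Rightarrow> real"
  assumes h: "continuous_on UNIV h" and 0: "\<And>y. y \<notin> {a..b} \<Longrightarrow> h y = 0"
  shows "(LINT y|lebesgue. h y) = integral (cbox a b) h"
proof -
  have "integrable lebesgue (\<lambda>y. 1 * h y)"
  proof (rule integrable_mult_compact_support[OF locally_integrable_continuous h])
    show "h x = 0" if "\<bar>x\<bar> > max \<bar>a\<bar> \<bar>b\<bar>" for x
      using that by (intro 0) auto
  qed simp
  then have "(h has_integral (LINT y|lebesgue. h y)) UNIV"
    using has_integral_integral_lebesgue by simp
  moreover have "(h has_integral integral (cbox a b) h) (cbox a b)"
    using h by (intro integrable_integral integrable_continuous continuous_on_subset[OF h]) auto
  then have "(h has_integral integral (cbox a b) h) UNIV"
    by (rule has_integral_on_superset) (use 0 in auto)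
  ultimately show ?thesis
    by (rule has_integral_unique)
qed

text \<open>The parameter sits only in the kernel, so \<open>v\<close> need not be differentiated;
  the minus sign is the inner derivative of \<open>y - x\<close>.\<close>

lemma mollification_DERIV:
  assumes v: "continuous_on UNIV v" and \<rho>: "test_function \<rho>"
  shows "((\<lambda>x. LINT y|lebesgue. v y * \<rho> (y - x)) has_real_derivative
    - (LINT y|lebesgue. v y * deriv \<rho> (y - x0))) (at x0)"
proof -
  obtain R1 where R1: "\<And>x. \<bar>x\<bar> > R1 \<Longrightarrow> \<rho> x = 0"
    using test_function_bound[OF \<rho>] by metis
  obtain R2 where R2: "\<And>x. \<bar>x\<bar> > R2 \<Longrightarrow> deriv \<rho> x = 0"
    using test_function_bound[OF test_function_deriv[OF \<rho>]] by metis
  have sm: "smooth \<rho>"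
    using \<rho> by (simp add: test_function_def)
  \<comment> \<open>The extra 1 lets one interval around \<open>x0\<close> contain the supports of
    the kernels for all \<open>x\<close> within distance 1 of \<open>x0\<close>.\<close>
  define R where "R = max R1 R2 + 1"
  define a b where "a = x0 - R" and "b = x0 + R"
  let ?U = "{x0 - 1<..<x0 + 1}"
  have c1: "continuous_on UNIV \<rho>" and c2: "continuous_on UNIV (deriv \<rho>)"
    using sm smooth_continuous_on smooth_deriv by auto
  have eq1: "(LINT y|lebesgue. v y * \<rho> (y - x)) = integral (cbox a b) (\<lambda>y. v y * \<rho> (y - x))"
    and eq2: "(LINT y|lebesgue. v y * deriv \<rho> (y - x)) = integral (cbox a b) (\<lambda>y. v y * deriv \<rho> (y - x))"
    if "x \<in> ?U" for x
  proof -
    have *: "\<bar>y - x\<bar> > R1" "\<bar>y - x\<bar> > R2" if "y \<notin> {a..b}" for y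
      using that \<open>x \<in> ?U\<close> by (auto simp: a_def b_def R_def)
    show "(LINT y|lebesgue. v y * \<rho> (y - x)) = integral (cbox a b) (\<lambda>y. v y * \<rho> (y - x))"
      by (intro lebesgue_integral_eq_integral_cbox continuous_intros v continuous_on_compose2[OF c1])
        (use * R1 in auto)
    show "(LINT y|lebesgue. v y * deriv \<rho> (y - x)) = integral (cbox a b) (\<lambda>y. v y * deriv \<rho> (y - x))"
      by (intro lebesgue_integral_eq_integral_cbox continuous_intros v continuous_on_compose2[OF c2])
        (use * R2 in auto)
  qed
  have "((\<lambda>x. integral (cbox a b) (\<lambda>y. v y * \<rho> (y - x))) has_real_derivative
      integral (cbox a b) (\<lambda>y. v y * (- deriv \<rho> (y - x0)))) (at x0 within ?U)"
  proof (rule leibniz_rule_field_derivative)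
    show "((\<lambda>x. v y * \<rho> (y - x)) has_real_derivative v y * (- deriv \<rho> (y - x))) (at x within ?U)" for x y
    proof -
      have "((\<lambda>x. \<rho> (y - x)) has_real_derivative deriv \<rho> (y - x) * (-1)) (at x)"
        by (rule DERIV_chain2[OF smooth_DERIV[OF sm]]) (auto intro!: derivative_eq_intros)
      then show ?thesis
        using DERIV_cmult[of "\<lambda>x. \<rho> (y - x)" _ x UNIV "v y"] has_field_derivative_at_within by fastforce
    qed
    show "(\<lambda>y. v y * \<rho> (y - x)) integrable_on cbox a b" for x
      by (intro integrable_continuous continuous_intros continuous_on_subset[OF v]
          continuous_on_compose2[OF c1]) auto
    show "continuous_on (?U \<times> cbox a b) (\<lambda>(x, y). v y * (- deriv \<rho> (y - x)))"
      unfolding split_beta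
      by (intro continuous_intros continuous_on_compose2[OF v] continuous_on_compose2[OF c2]) auto
  qed auto
  then have "((\<lambda>x. integral (cbox a b) (\<lambda>y. v y * \<rho> (y - x))) has_real_derivative
      - (LINT y|lebesgue. v y * deriv \<rho> (y - x0))) (at x0)"
    by (simp add: at_within_open[of x0 ?U] eq2)
  then show ?thesis
    by (rule has_field_derivative_transform_within_open[where S = ?U]) (use eq1 in auto)
qed

lemma mollifier_exists:
  assumes "\<epsilon> > 0"
  obtains \<rho> where "test_function \<rho>" "\<And>x. \<rho> x \<ge> 0" "\<And>x. \<bar>x\<bar> \<ge> \<epsilon> \<Longrightarrow> \<rho> x = 0"
    "\<And>x. (LINT y|lebesgue. \<rho> (y - x)) = 1"
proof -
  let ?b = "bump 1 (- \<epsilon>) \<epsilon>"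
  define I where "I = (LINT y|lebesgue. ?b y)"
  have i: "integrable lebesgue ?b"
    using integrable_mult_test_function[OF locally_integrable_continuous test_function_bump, of "\<lambda>x. 1" 1] by simp
  \<comment> \<open>A nonnegative function with integral 0 vanishes almost everywhere, whereas the
    bump is positive on an interval of positive measure.\<close>
  have "I \<noteq> 0"
  proof
    assume "I = 0"
    then have "AE x in lebesgue. ?b x = 0"
      using integral_nonneg_eq_0_iff_AE[OF i] bump_nonneg by (simp add: I_def)
    then have "AE x in lebesgue. x \<notin> box (- \<epsilon>) \<epsilon>"
      by eventually_elim (metis bump_pos_iff box_real(1) greaterThanLessThan_iff less_irrefl zero_less_one)
    then have "negligible (box (- \<epsilon>) \<epsilon>)"
      by (subst negligible_iff_null_sets, subst AE_iff_null_sets) (auto simp del: box_real)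
    then show False
      using assms negligible_interval(2)[of "- \<epsilon>" \<epsilon>] by simp
  qed
  then have "I > 0"
    using bump_nonneg unfolding I_def by (metis Bochner_Integration.integral_nonneg order_less_le)
  define \<rho> where "\<rho> = (\<lambda>x. ?b x * (1 / I))"
  have s: "smooth \<rho>"
    unfolding \<rho>_def by (intro smooth_mult smooth_bump smooth_const)
  have z: "\<rho> x = 0" if "\<bar>x\<bar> \<ge> \<epsilon>" for x
    unfolding \<rho>_def using that by (subst bump_eq_0) auto
  show ?thesis
  proof
    show "test_function \<rho>"
      using z by (intro test_functionI[OF s, of "- \<epsilon>" \<epsilon>]) auto
    show "\<rho> x \<ge> 0" for x
      using \<open>I > 0\<close> bump_nonneg by (simp add: \<rho>_def)
    show "(LINT y|lebesgue. \<rho> (y - x)) = 1" for x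
    proof -
      have c: "?b \<in> borel_measurable borel"
        using smooth_continuous_on[OF smooth_bump] by (rule borel_measurable_continuous_onI)
      then have c': "(\<lambda>y. ?b (y - x)) \<in> borel_measurable borel"
        by measurable
      have "(LINT y|lebesgue. ?b (y - x)) = (LINT y|lborel. ?b (- x + 1 * y))"
        using integral_completion[of _ lborel] c' by simp
      also have "\<dots> = (LINT y|lborel. ?b y)"
        using lborel_integral_real_affine[of 1 ?b "- x"] by simp
      also have "\<dots> = I"
        using integral_completion[of ?b lborel] c by (simp add: I_def)
      finally show ?thesis
        using \<open>I \<noteq> 0\<close> by (simp add: \<rho>_def)
    qed
  qed (rule z)
qed

text \<open>The kernel is a probability density concentrated within \<open>\<epsilon>\<close> of
  \<open>x\<close>, so the mollification averages values of \<open>v\<close> that lie within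
  \<open>\<delta>\<close> of \<open>v x\<close>.\<close>

lemma mollification_close:
  assumes v: "continuous_on UNIV v" and \<rho>: "test_function \<rho>" "\<And>x. \<rho> x \<ge> 0" "\<And>x. \<bar>x\<bar> \<ge> \<epsilon> \<Longrightarrow> \<rho> x = 0"
    "(LINT y|lebesgue. \<rho> (y - x)) = 1"
    and close: "\<And>y. \<bar>y - x\<bar> < \<epsilon> \<Longrightarrow> \<bar>v y - v x\<bar> \<le> \<delta>"
  shows "\<bar>(LINT y|lebesgue. v y * \<rho> (y - x)) - v x\<bar> \<le> \<delta>"
proof -
  have c: "continuous_on UNIV (\<lambda>y. \<rho> (y - x))"
    using \<rho>(1) by (intro continuous_on_compose2[OF smooth_continuous_on[of \<rho> UNIV]] continuous_intros)
      (auto simp: test_function_def)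
  have I: "integrable lebesgue (\<lambda>y. f y * \<rho> (y - x))" if "continuous_on UNIV f" for f
  proof (rule integrable_mult_compact_support[OF locally_integrable_continuous[OF that] c])
    show "\<rho> (y - x) = 0" if "\<bar>y\<bar> > \<epsilon> + \<bar>x\<bar>" for y
      using that by (intro \<rho>(3)) auto
  qed
  have I1: "integrable lebesgue (\<lambda>y. \<rho> (y - x))"
    using I[of "\<lambda>y. 1"] by simp
  have I2: "integrable lebesgue (\<lambda>y. v y * \<rho> (y - x))"
    by (rule I[OF v])
  have I3: "integrable lebesgue (\<lambda>y. (v y - v x) * \<rho> (y - x))"
    by (intro I continuous_intros v)
  have "(LINT y|lebesgue. v y * \<rho> (y - x)) - v x = (LINT y|lebesgue. v y * \<rho> (y - x)) - (LINT y|lebesgue. v x * \<rho> (y - x))"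
    using \<rho>(4) by simp
  also have "\<dots> = (LINT y|lebesgue. (v y - v x) * \<rho> (y - x))"
    using I1 I2 by (subst Bochner_Integration.integral_diff[symmetric]) (auto simp: algebra_simps)
  also have "\<bar>\<dots>\<bar> \<le> (LINT y|lebesgue. \<bar>(v y - v x) * \<rho> (y - x)\<bar>)"
    by (rule integral_abs_bound)
  also have "\<dots> \<le> (LINT y|lebesgue. \<delta> * \<rho> (y - x))"
  proof (rule integral_mono)
    show "integrable lebesgue (\<lambda>y. \<bar>(v y - v x) * \<rho> (y - x)\<bar>)"
      using I3 by (rule integrable_abs)
    show "integrable lebesgue (\<lambda>y. \<delta> * \<rho> (y - x))"
      using I1 by simp
    show "\<bar>(v y - v x) * \<rho> (y - x)\<bar> \<le> \<delta> * \<rho> (y - x)" for y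
    proof (cases "\<bar>y - x\<bar> < \<epsilon>")
      case True
      then show ?thesis
        using close \<rho>(2) by (simp add: abs_mult mult_right_mono)
    next
      case False
      then show ?thesis
        using \<rho>(3) by simp
    qed
  qed
  also have "\<dots> = \<delta>"
    using \<rho>(4) by simp
  finally show ?thesis .
qed

text \<open>Both derivatives fall on the test function, so that mollification gives classical approximate
  supersolutions without any regularity theory for \<open>v\<close>.\<close>

definition weak_supersolution :: "(real \<Rightarrow> real) \<Rightarrow> (real \<Rightarrow> real) \<Rightarrow> bool" where
  "weak_supersolution c v \<longleftrightarrow> continuous_on UNIV v \<and>
     (\<forall>\<eta>. test_function \<eta> \<longrightarrow> (\<forall>x. \<eta> x \<ge> 0) \<longrightarrow>
        (LINT x|lebesgue. v x * deriv (deriv \<eta>) x) \<le> - (LINT x|lebesgue. c x * v x * \<eta> x))"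

text \<open>Testing the weak inequality with a translated mollifier bounds \<open>V''\<close> by an
  average of \<open>- c * v\<close>. As \<open>c\<close> varies, this average equals
  \<open>- c x * V x\<close> only up to an error, which a narrow kernel makes small uniformly on
  \<open>{a..d}\<close>.\<close>

lemma weak_supersolution_mollify:
  assumes c: "continuous_on UNIV c" and v: "weak_supersolution c v" and \<kappa>: "\<kappa> > 0"
  shows "\<exists>V V' V''. (\<forall>x. (V has_real_derivative V' x) (at x)) \<and> (\<forall>x. (V' has_real_derivative V'' x) (at x)) \<and>
    (\<forall>x\<in>{a..d}. \<bar>V x - v x\<bar> \<le> \<kappa> \<and> V'' x + c x * V x \<le> \<kappa>)"
proof -
  have cv: "continuous_on UNIV v"
    using v by (simp add: weak_supersolution_def)
  then have ccv: "continuous_on UNIV (\<lambda>x. c x * v x)"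
    using c by (intro continuous_intros)
  \<comment> \<open>Capping the radius at 1 keeps \<open>y\<close> inside
    \<open>{a - 1..d + 1}\<close>, where uniform continuity holds.\<close>
  have uc: "\<exists>\<epsilon>\<in>{0<..1}. \<forall>x\<in>{a..d}. \<forall>y. \<bar>y - x\<bar> < \<epsilon> \<longrightarrow> \<bar>f y - f x\<bar> \<le> \<delta>"
    if f: "continuous_on UNIV f" and "\<delta> > 0" for f :: "real \<Rightarrow> real" and \<delta>
  proof -
    have "uniformly_continuous_on {a - 1..d + 1} f"
      using f by (intro compact_uniformly_continuous continuous_on_subset[OF f]) auto
    then obtain e where e: "e > 0" "\<And>x y. x \<in> {a - 1..d + 1} \<Longrightarrow> y \<in> {a - 1..d + 1} \<Longrightarrow>
        dist y x < e \<Longrightarrow> dist (f y) (f x) < \<delta>"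
      using \<open>\<delta> > 0\<close> unfolding uniformly_continuous_on_def by metis
    show ?thesis
    proof (rule bexI[of _ "min e 1"], intro ballI allI impI)
      fix x y
      assume "x \<in> {a..d}" "\<bar>y - x\<bar> < min e 1"
      then show "\<bar>f y - f x\<bar> \<le> \<delta>"
        using e(2)[of x y] by (auto simp: dist_real_def abs_less_iff)
    qed (use e(1) in auto)
  qed
  have "bounded (c ` {a..d})"
    by (intro compact_imp_bounded compact_continuous_image continuous_on_subset[OF c]) auto
  then obtain C where C: "C > 0" "\<And>x. x \<in> {a..d} \<Longrightarrow> \<bar>c x\<bar> \<le> C"
    unfolding bounded_pos by auto
  \<comment> \<open>The error is \<open>\<delta>\<close> for averaging \<open>c * v\<close> plus at
    most \<open>C * \<delta>\<close> for replacing \<open>v x\<close> by \<open>V x\<close>;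
    together they make \<open>\<kappa>\<close>.\<close>
  define \<delta> where "\<delta> = \<kappa> / (C + 1)"
  have \<delta>: "\<delta> > 0" "C * \<delta> + \<delta> = \<kappa>"
    using C(1) \<kappa> by (simp_all add: \<delta>_def) (simp add: divide_simps, simp add: algebra_simps)
  then have "\<delta> \<le> \<kappa>"
    using C(1) by (smt (verit) mult_pos_pos)
  obtain \<epsilon>1 where \<epsilon>1: "\<epsilon>1 > 0" "\<And>x y. x \<in> {a..d} \<Longrightarrow> \<bar>y - x\<bar> < \<epsilon>1 \<Longrightarrow> \<bar>v y - v x\<bar> \<le> \<delta>"
    using uc[OF cv \<delta>(1)] by auto
  obtain \<epsilon>2 where \<epsilon>2: "\<epsilon>2 > 0" "\<And>x y. x \<in> {a..d} \<Longrightarrow> \<bar>y - x\<bar> < \<epsilon>2 \<Longrightarrow> \<bar>c y * v y - c x * v x\<bar> \<le> \<delta>"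
    using uc[OF ccv \<delta>(1)] by auto
  define \<epsilon> where "\<epsilon> = min \<epsilon>1 \<epsilon>2"
  obtain \<rho> where \<rho>: "test_function \<rho>" "\<And>x. \<rho> x \<ge> 0" "\<And>x. \<bar>x\<bar> \<ge> \<epsilon> \<Longrightarrow> \<rho> x = 0"
    "\<And>x. (LINT y|lebesgue. \<rho> (y - x)) = 1"
    using mollifier_exists[of \<epsilon>] \<epsilon>1(1) \<epsilon>2(1) by (auto simp: \<epsilon>_def)
  define V where "V = (\<lambda>x. LINT y|lebesgue. v y * \<rho> (y - x))"
  define V' where "V' = (\<lambda>x. - (LINT y|lebesgue. v y * deriv \<rho> (y - x)))"
  define V'' where "V'' = (\<lambda>x. LINT y|lebesgue. v y * deriv (deriv \<rho>) (y - x))"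
  have "(V has_real_derivative V' x) (at x)" for x
    unfolding V_def V'_def by (rule mollification_DERIV[OF cv \<rho>(1)])
  moreover have "(V' has_real_derivative V'' x) (at x)" for x
    unfolding V'_def V''_def
    using DERIV_minus[OF mollification_DERIV[OF cv test_function_deriv[OF \<rho>(1)]]] by simp
  moreover have "\<bar>V x - v x\<bar> \<le> \<kappa> \<and> V'' x + c x * V x \<le> \<kappa>" if x: "x \<in> {a..d}" for x
  proof
    have "\<bar>V x - v x\<bar> \<le> \<delta>"
      unfolding V_def using \<rho> \<epsilon>1(2)[OF x] by (intro mollification_close[OF cv \<rho>(1-3)]) (auto simp: \<epsilon>_def)
    then show "\<bar>V x - v x\<bar> \<le> \<kappa>" using \<open>\<delta> \<le> \<kappa>\<close> by simp
    define \<eta> where "\<eta> = (\<lambda>y. \<rho> (y - x))"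
    have sm: "smooth \<rho>" using \<rho>(1) by (simp add: test_function_def)
    have d: "deriv (\<lambda>y. f (y - x)) = (\<lambda>y. deriv f (y - x))" if "smooth f" for f
    proof
      fix y
      have "((\<lambda>y. f (y - x)) has_real_derivative deriv f (y - x) * 1) (at y)"
        by (rule DERIV_chain2[OF smooth_DERIV[OF that]]) (auto intro!: derivative_eq_intros)
      then show "deriv (\<lambda>y. f (y - x)) y = deriv f (y - x)"
        by (simp add: DERIV_imp_deriv)
    qed
    have "test_function \<eta>"
    proof (rule test_functionI)
      show "smooth \<eta>"
        using smooth_affine[OF sm, of 1 "- x"] by (simp add: \<eta>_def)
      show "\<eta> y = 0" if "y < x - \<epsilon> \<or> y > x + \<epsilon>" for y
        unfolding \<eta>_def using that by (intro \<rho>(3)) auto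
    qed
    moreover have "\<forall>y. \<eta> y \<ge> 0"
      by (simp add: \<eta>_def \<rho>(2))
    moreover have "deriv (deriv \<eta>) = (\<lambda>y. deriv (deriv \<rho>) (y - x))"
      unfolding \<eta>_def d[OF sm] d[OF smooth_deriv[OF sm]] ..
    ultimately have "V'' x \<le> - (LINT y|lebesgue. c y * v y * \<rho> (y - x))"
      using v unfolding weak_supersolution_def V''_def by (auto simp: \<eta>_def)
    moreover have "\<bar>(LINT y|lebesgue. c y * v y * \<rho> (y - x)) - c x * v x\<bar> \<le> \<delta>"
      using \<rho> \<epsilon>2(2)[OF x] by (intro mollification_close[OF ccv \<rho>(1-3)]) (auto simp: \<epsilon>_def)
    moreover have "c x * V x - c x * v x \<le> C * \<delta>"
    proof -
      have "c x * V x - c x * v x \<le> \<bar>c x\<bar> * \<bar>V x - v x\<bar>"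
        by (metis abs_ge_self abs_mult right_diff_distrib)
      also have "\<dots> \<le> C * \<delta>"
        using C(2)[OF x] \<open>\<bar>V x - v x\<bar> \<le> \<delta>\<close> by (intro mult_mono) auto
      finally show ?thesis .
    qed
    ultimately show "V'' x + c x * V x \<le> \<kappa>"
      using \<delta>(2) by linarith
  qed
  ultimately show ?thesis by blast
qed

text \<open>Since \<open>s' = 1 / u^2\<close>, the derivative of \<open>V / u\<close> with respect
  to \<open>s\<close> is the Wronskian \<open>Q\<close>. Its derivative
  \<open>u * (V'' + c * V)\<close> is at most \<open>M * \<kappa>\<close>, so \<open>Q\<close> rises
  by at most \<open>L\<close> on \<open>{a..d}\<close>: the slopes left and right of
  \<open>b\<close> compare with \<open>Q b\<close> up to \<open>L\<close>.\<close>

lemma three_point_approx: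
  fixes u s :: "real \<Rightarrow> real"
  assumes u: "\<And>x. (u has_real_derivative u' x) (at x)" "\<And>x. (u' has_real_derivative - c x * u x) (at x)" "\<And>x. u x > 0"
    and s: "\<And>x. (s has_real_derivative 1 / (u x)\<^sup>2) (at x)"
    and V: "\<And>x. (V has_real_derivative V' x) (at x)" "\<And>x. (V' has_real_derivative V'' x) (at x)"
    and super: "\<And>x. x \<in> {a..d} \<Longrightarrow> V'' x + c x * V x \<le> \<kappa>"
    and M: "\<And>x. x \<in> {a..d} \<Longrightarrow> u x \<le> M" and \<kappa>: "\<kappa> \<ge> 0" and abd: "a < b" "b < d"
  shows "(V d / u d - V b / u b) * (s b - s a) \<le>
    (V b / u b - V a / u a) * (s d - s b) + 2 * (M * \<kappa> * (d - a)) * ((s b - s a) * (s d - s b))"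
proof -
  define Q where "Q = (\<lambda>x. u x * V' x - u' x * V x)"
  define L where "L = M * \<kappa> * (d - a)"
  have Q': "(Q has_real_derivative u x * (V'' x + c x * V x)) (at x)" for x
    unfolding Q_def by (auto intro!: derivative_eq_intros u V simp: algebra_simps)
  have Q_le: "Q y - Q x \<le> L" if "a \<le> x" "x \<le> y" "y \<le> d" for x y
  proof -
    have "M \<ge> 0" using M[of a] u(3)[of a] abd by auto
    have "Q y - M * \<kappa> * y \<le> Q x - M * \<kappa> * x"
    proof (rule DERIV_nonpos_imp_nonincreasing[OF that(2)])
      fix t
      assume t: "x \<le> t" "t \<le> y"
      have "u t * (V'' t + c t * V t) \<le> u t * \<kappa>"
        using super[of t] u(3)[of t] t that by (intro mult_left_mono) auto
      also have "\<dots> \<le> M * \<kappa>"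
        using M[of t] \<kappa> t that by (intro mult_right_mono) auto
      finally have "u t * (V'' t + c t * V t) - M * \<kappa> \<le> 0" by simp
      moreover have "((\<lambda>y. Q y - M * \<kappa> * y) has_real_derivative u t * (V'' t + c t * V t) - M * \<kappa>) (at t)"
        by (auto intro!: derivative_eq_intros Q')
      ultimately show "\<exists>y. ((\<lambda>y. Q y - M * \<kappa> * y) has_real_derivative y) (at t) \<and> y \<le> 0"
        by blast
    qed
    then have "Q y - Q x \<le> M * \<kappa> * (y - x)"
      by (simp add: algebra_simps)
    also have "\<dots> \<le> L"
      unfolding L_def using \<open>M \<ge> 0\<close> \<kappa> that by (intro mult_left_mono) auto
    finally show ?thesis .
  qed
  have Z': "((\<lambda>x. V x / u x - k * s x) has_real_derivative (Q x - k) * (1 / (u x)\<^sup>2)) (at x)" for x k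
    using u(3)[of x]
    by (auto intro!: derivative_eq_intros u V s simp: Q_def power2_eq_square field_simps)
  \<comment> \<open>On \<open>{a..b}\<close> the slope \<open>Q\<close> is at least
    \<open>Q b - L\<close>, so subtracting a line of that slope leaves a nondecreasing function. The
    right side is treated dually with \<open>Q b + L\<close>.\<close>
  have "V a / u a - (Q b - L) * s a \<le> V b / u b - (Q b - L) * s b"
  proof (rule DERIV_nonneg_imp_nondecreasing[of a b "\<lambda>x. V x / u x - (Q b - L) * s x"])
    show "\<exists>y. ((\<lambda>x. V x / u x - (Q b - L) * s x) has_real_derivative y) (at t) \<and> y \<ge> 0"
      if "a \<le> t" "t \<le> b" for t
      using Z'[of "Q b - L" t] Q_le[of t b] that abd by force
  qed (use abd in simp)
  then have 1: "(Q b - L) * (s b - s a) \<le> V b / u b - V a / u a"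
    by (simp add: algebra_simps)
  have "V d / u d - (Q b + L) * s d \<le> V b / u b - (Q b + L) * s b"
  proof (rule DERIV_nonpos_imp_nonincreasing[of b d "\<lambda>x. V x / u x - (Q b + L) * s x"])
    show "\<exists>y. ((\<lambda>x. V x / u x - (Q b + L) * s x) has_real_derivative y) (at t) \<and> y \<le> 0"
      if "b \<le> t" "t \<le> d" for t
    proof -
      have "(Q t - (Q b + L)) * (1 / (u t)\<^sup>2) \<le> 0"
        using Q_le[of b t] that abd by (intro mult_nonpos_nonneg) auto
      then show ?thesis using Z' by blast
    qed
  qed (use abd in simp)
  then have 2: "V d / u d - V b / u b \<le> (Q b + L) * (s d - s b)"
    by (simp add: algebra_simps)
  have mono: "s x \<le> s y" if "x \<le> y" for x y
  proof (rule DERIV_nonneg_imp_nondecreasing[OF that])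
    show "\<exists>y. (s has_real_derivative y) (at t) \<and> 0 \<le> y" for t
      using s[of t] by fastforce
  qed
  have "(V d / u d - V b / u b) * (s b - s a) \<le> ((Q b + L) * (s d - s b)) * (s b - s a)"
    using 2 mono[of a b] abd by (intro mult_right_mono) auto
  also have "\<dots> = ((Q b - L) * (s b - s a)) * (s d - s b) + 2 * L * ((s b - s a) * (s d - s b))"
    by (simp add: algebra_simps)
  also have "\<dots> \<le> (V b / u b - V a / u a) * (s d - s b) + 2 * L * ((s b - s a) * (s d - s b))"
    using 1 mono[of b d] abd by (intro add_right_mono mult_right_mono) auto
  finally show ?thesis by (simp add: L_def)
qed

text \<open>The three-point inequality involves values of the mollified function but none of its
  derivatives, so it survives the pointwise limit
  \<open>\<kappa> \<longlonglongrightarrow> 0\<close>, where the error term disappears.\<close>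

lemma weak_supersolution_concave:
  fixes u s :: "real \<Rightarrow> real"
  assumes c: "continuous_on UNIV c"
    and u: "\<And>x. (u has_real_derivative u' x) (at x)" "\<And>x. (u' has_real_derivative - c x * u x) (at x)" "\<And>x. u x > 0"
    and s: "\<And>x. (s has_real_derivative 1 / (u x)\<^sup>2) (at x)"
    and v: "weak_supersolution c v" and abd: "a < b" "b < d"
  shows "(v d / u d - v b / u b) * (s b - s a) \<le> (v b / u b - v a / u a) * (s d - s b)"
proof -
  have "continuous_on UNIV u"
    using u(1) DERIV_continuous_on by blast
  then have "bounded (u ` {a..d})"
    by (intro compact_imp_bounded compact_continuous_image) (auto intro: continuous_on_subset)
  then obtain M where M: "\<And>x. x \<in> {a..d} \<Longrightarrow> u x \<le> M"
    by (metis bounded_iff image_eqI real_norm_def abs_le_D1)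
  define \<kappa> where "\<kappa> = (\<lambda>n. inverse (real (Suc n)))"
  have \<kappa>0: "\<kappa> \<longlonglongrightarrow> 0"
    unfolding \<kappa>_def by (rule LIMSEQ_inverse_real_of_nat)
  have \<kappa>: "\<kappa> n > 0" for n
    by (simp add: \<kappa>_def)
  have "\<exists>V. (\<forall>x\<in>{a..d}. \<bar>V x - v x\<bar> \<le> \<kappa> n) \<and> (V d / u d - V b / u b) * (s b - s a) \<le>
    (V b / u b - V a / u a) * (s d - s b) + 2 * (M * \<kappa> n * (d - a)) * ((s b - s a) * (s d - s b))" for n
  proof -
    obtain V V' V'' where V: "\<And>x. (V has_real_derivative V' x) (at x)" "\<And>x. (V' has_real_derivative V'' x) (at x)"
      "\<And>x. x \<in> {a..d} \<Longrightarrow> \<bar>V x - v x\<bar> \<le> \<kappa> n \<and> V'' x + c x * V x \<le> \<kappa> n"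
      using weak_supersolution_mollify[OF c v \<kappa>[of n], of a d] by blast
    have "(V d / u d - V b / u b) * (s b - s a) \<le>
      (V b / u b - V a / u a) * (s d - s b) + 2 * (M * \<kappa> n * (d - a)) * ((s b - s a) * (s d - s b))"
      using V(3) \<kappa>[of n] by (intro three_point_approx[OF u s V(1,2) _ M _ abd]) auto
    then show ?thesis using V(3) by blast
  qed
  then obtain V where V: "\<And>n x. x \<in> {a..d} \<Longrightarrow> \<bar>V n x - v x\<bar> \<le> \<kappa> n"
    "\<And>n. (V n d / u d - V n b / u b) * (s b - s a) \<le>
    (V n b / u b - V n a / u a) * (s d - s b) + 2 * (M * \<kappa> n * (d - a)) * ((s b - s a) * (s d - s b))"
    by metis
  have lim: "(\<lambda>n. V n x) \<longlonglongrightarrow> v x" if "x \<in> {a..d}" for x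
  proof -
    have "(\<lambda>n. V n x - v x) \<longlonglongrightarrow> 0"
      by (rule Lim_null_comparison[OF _ \<kappa>0]) (use V(1)[OF that] in simp)
    then show ?thesis by (rule LIM_zero_cancel)
  qed
  have nz: "u x \<noteq> 0" for x
    using u(3)[of x] by simp
  have "(v d / u d - v b / u b) * (s b - s a) \<le>
    (v b / u b - v a / u a) * (s d - s b) + 2 * (M * 0 * (d - a)) * ((s b - s a) * (s d - s b))"
  proof (rule LIMSEQ_le)
    show "(\<lambda>n. (V n d / u d - V n b / u b) * (s b - s a)) \<longlonglongrightarrow> (v d / u d - v b / u b) * (s b - s a)"
      using abd by (intro tendsto_intros lim nz) auto
    show "(\<lambda>n. (V n b / u b - V n a / u a) * (s d - s b) + 2 * (M * \<kappa> n * (d - a)) * ((s b - s a) * (s d - s b)))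
      \<longlonglongrightarrow> (v b / u b - v a / u a) * (s d - s b) + 2 * (M * 0 * (d - a)) * ((s b - s a) * (s d - s b))"
      using abd by (intro tendsto_intros lim nz \<kappa>0) auto
  qed (use V(2) in blast)
  then show ?thesis by simp
qed

section \<open>Criticality and eigenfunctions\<close>

lemma div_op_one: "div_op (\<lambda>x. 1) c u x = weak_deriv (weak_deriv u) x + c x * u x"
  by (simp add: div_op_def)

text \<open>The factor \<open>\<sigma>\<close> is 1 for supersolutions and -1 for subsolutions, so
  that one concavity statement serves both.\<close>

lemma weak_supersolution_if_W21_loc:
  assumes c: "continuous_on UNIV c" and u: "u \<in> W21_loc"
    and le: "AE x in lebesgue. \<sigma> * div_op (\<lambda>x. 1) c u x \<le> 0"
  shows "weak_supersolution c (\<lambda>x. \<sigma> * u x)"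
  unfolding weak_supersolution_def
proof (intro conjI allI impI)
  have cu: "continuous_on UNIV u"
    using u by (simp add: W21_loc_def)
  then show "continuous_on UNIV (\<lambda>x. \<sigma> * u x)"
    by (intro continuous_intros)
  fix \<eta> :: "real \<Rightarrow> real"
  assume \<eta>: "test_function \<eta>" "\<forall>x. \<eta> x \<ge> 0"
  let ?w = "weak_deriv (weak_deriv u)"
  have i1: "integrable lebesgue (\<lambda>x. ?w x * \<eta> x)"
    using W21_loc_second_weak_deriv(1)[OF u] \<eta>(1) by (rule integrable_mult_test_function)
  have i2: "integrable lebesgue (\<lambda>x. c x * (\<sigma> * u x) * \<eta> x)"
    using \<eta>(1) by (intro integrable_mult_test_function locally_integrable_continuous continuous_intros c cu)
  have "(LINT x|lebesgue. \<sigma> * u x * deriv (deriv \<eta>) x) = \<sigma> * (LINT x|lebesgue. u x * deriv (deriv \<eta>) x)"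
    by (simp add: mult.assoc)
  also have "\<dots> = (LINT x|lebesgue. \<sigma> * (?w x * \<eta> x))"
    using W21_loc_second_weak_deriv(2)[OF u \<eta>(1)] by simp
  also have "\<dots> \<le> (LINT x|lebesgue. - (c x * (\<sigma> * u x) * \<eta> x))"
  proof (rule integral_mono_AE)
    show "AE x in lebesgue. \<sigma> * (?w x * \<eta> x) \<le> - (c x * (\<sigma> * u x) * \<eta> x)"
      using le
    proof eventually_elim
      case (elim x)
      then have "\<sigma> * (?w x + c x * u x) * \<eta> x \<le> 0"
        using \<eta>(2) by (intro mult_nonpos_nonneg[of "\<sigma> * (?w x + c x * u x)"]) (simp_all add: div_op_one)
      then show ?case by (simp add: algebra_simps)
    qed
  qed (use i1 i2 in auto)
  finally show "(LINT x|lebesgue. \<sigma> * u x * deriv (deriv \<eta>) x) \<le> - (LINT x|lebesgue. c x * (\<sigma> * u x) * \<eta> x)"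
    using i2 by simp
qed

text \<open>The differential inequalities refer to a chosen weak derivative. Against test functions
  it integrates like \<open>u''\<close>, hence agrees with it almost everywhere by the fundamental
  lemma.\<close>

lemma classical_W21_loc:
  assumes u: "\<And>x. (u has_real_derivative u' x) (at x)" "\<And>x. (u' has_real_derivative u'' x) (at x)"
    and u'': "continuous_on UNIV u''"
  shows "u \<in> W21_loc" "AE x in lebesgue. weak_deriv (weak_deriv u) x = u'' x"
proof -
  have "continuous_on UNIV u" "continuous_on UNIV u'"
    using u DERIV_continuous_on by blast+
  then have w: "has_weak_deriv u u'" "has_weak_deriv u' u''"
    using has_weak_deriv_C1 u u'' by blast+
  show W: "u \<in> W21_loc"
    using w \<open>continuous_on UNIV u\<close> by (auto simp: W21_loc_def)
  let ?w = "weak_deriv (weak_deriv u)"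
  have lw: "locally_integrable ?w" and lu: "locally_integrable u''"
    using W21_loc_second_weak_deriv(1)[OF W] u'' locally_integrable_continuous by auto
  have "AE x in lebesgue. ?w x - u'' x = 0"
  proof (rule fundamental_lemma_of_variations)
    show "locally_integrable (\<lambda>x. ?w x - u'' x)"
      using lw lu by (auto simp: locally_integrable_def)
    fix \<eta>
    assume \<eta>: "test_function \<eta>"
    have "(LINT x|lebesgue. u x * deriv (deriv \<eta>) x) = (LINT x|lebesgue. u'' x * \<eta> x)"
      using w test_function_deriv[OF \<eta>] \<eta> unfolding has_weak_deriv_def by simp
    then have "(LINT x|lebesgue. ?w x * \<eta> x) = (LINT x|lebesgue. u'' x * \<eta> x)"
      using W21_loc_second_weak_deriv(2)[OF W \<eta>] by simp
    then show "(LINT x|lebesgue. (?w x - u'' x) * \<eta> x) = 0"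
      using integrable_mult_test_function[OF lw \<eta>] integrable_mult_test_function[OF lu \<eta>]
      by (simp add: left_diff_distrib)
  qed
  then show "AE x in lebesgue. ?w x = u'' x" by simp
qed

text \<open>A concave function of \<open>s\<close> lies below the extension of each of its chords. A
  falling chord becomes negative as \<open>s\<close> goes to the right, a rising one as
  \<open>s\<close> goes to the left, so positivity excludes both.\<close>

lemma positive_concave_constant:
  fixes s z :: "real \<Rightarrow> real"
  assumes conc: "\<And>a b d. a < b \<Longrightarrow> b < d \<Longrightarrow> (z d - z b) * (s b - s a) \<le> (z b - z a) * (s d - s b)"
    and pos: "\<And>x. z x > 0" and mono: "strict_mono s"
    and top: "\<And>B. \<exists>x. s x > B" and bot: "\<And>B. \<exists>x. s x < B"
  shows "z x = z y"
proof -
  have incr: "z a \<le> z b" if "a < b" for a b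
  proof (rule ccontr)
    assume "\<not> z a \<le> z b"
    then have k: "z a - z b > 0" by simp
    \<comment> \<open>The bound is the value of \<open>s\<close> at which the chord through
      \<open>a\<close> and \<open>b\<close> reaches 0.\<close>
    obtain d where d: "s d > s b + z b * (s b - s a) / (z a - z b)"
      using top by blast
    have sab: "s a < s b"
      using mono that by (rule strict_monoD)
    then have "z b * (s b - s a) / (z a - z b) \<ge> 0"
      using k pos[of b] by simp
    then have "b < d"
      using d mono strict_mono_less[of s b d] by linarith
    then have "(z d - z b) * (s b - s a) \<le> (z b - z a) * (s d - s b)"
      using conc that by blast
    moreover have "z d * (s b - s a) > 0"
      using pos sab by simp
    ultimately have "(z a - z b) * (s d - s b) < z b * (s b - s a)"
      by (simp add: algebra_simps)
    then have "s d - s b < z b * (s b - s a) / (z a - z b)"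
      using k by (simp add: pos_less_divide_eq mult.commute)
    then show False using d by linarith
  qed
  have decr: "z b \<ge> z d" if "b < d" for b d
  proof (rule ccontr)
    assume "\<not> z b \<ge> z d"
    then have k: "z d - z b > 0" by simp
    \<comment> \<open>Mirror image: the chord through \<open>b\<close> and \<open>d\<close>,
      extended to the left, reaches 0 at this value of \<open>s\<close>.\<close>
    obtain a where a: "s a < s b - z b * (s d - s b) / (z d - z b)"
      using bot by blast
    have sbd: "s b < s d"
      using mono that by (rule strict_monoD)
    then have "z b * (s d - s b) / (z d - z b) \<ge> 0"
      using k pos[of b] by simp
    then have "a < b"
      using a mono strict_mono_less[of s a b] by linarith
    then have "(z d - z b) * (s b - s a) \<le> (z b - z a) * (s d - s b)"
      using conc that by blast
    moreover have "z a * (s d - s b) > 0"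
      using pos sbd by simp
    ultimately have "(z d - z b) * (s b - s a) < z b * (s d - s b)"
      by (simp add: algebra_simps)
    then have "s b - s a < z b * (s d - s b) / (z d - z b)"
      using k by (simp add: pos_less_divide_eq mult.commute)
    then show False using a by linarith
  qed
  show ?thesis
    by (metis incr decr linorder_neqE_linordered_idom order_antisym)
qed

text \<open>Translating by points where \<open>f\<close> exceeds \<open>n\<close> would make the
  values at 0 diverge along every subsequence.\<close>

lemma almost_periodic_bounded_above:
  assumes "almost_periodic f"
  shows "\<exists>B. \<forall>x. f x \<le> B"
proof (rule ccontr)
  assume "\<nexists>B. \<forall>x. f x \<le> B"
  then have "\<exists>x. f x > real n" for n :: nat
    by (meson not_le)
  then obtain X where X: "\<And>n. f (X n) > real n" by metis
  obtain r g where r: "strict_mono (r :: nat \<Rightarrow> nat)"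
    and lim: "uniform_limit UNIV (\<lambda>k x. f (x + X (r k))) g sequentially"
    using assms unfolding almost_periodic_def by blast
  have "(\<lambda>k. f (0 + X (r k))) \<longlonglongrightarrow> g 0"
    using lim by (rule tendsto_uniform_limitI) simp
  then have "Bseq (\<lambda>k. f (X (r k)))"
    using convergentI convergent_imp_Bseq by force
  then obtain K where K: "\<And>k. \<bar>f (X (r k))\<bar> \<le> K"
    unfolding Bseq_def by auto
  obtain k :: nat where "K < real k"
    using reals_Archimedean2 by blast
  also have "\<dots> \<le> real (r k)"
    using seq_suble[OF r] by simp
  finally show False
    using X[of "r k"] K[of k] by linarith
qed

text \<open>The unboundedness of \<open>s\<close> at both ends yields criticality; that of
  \<open>u\<close> on each half-line excludes bounded functions above a positive multiple of
  \<open>u\<close> there.\<close>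

locale ground_state =
  fixes c u u' s :: "real \<Rightarrow> real"
  assumes c: "continuous_on UNIV c"
    and u: "\<And>x. (u has_real_derivative u' x) (at x)" "\<And>x. (u' has_real_derivative - c x * u x) (at x)"
    and u_pos: "\<And>x. u x > 0"
    and s: "\<And>x. (s has_real_derivative 1 / (u x)\<^sup>2) (at x)"
    and s_top: "\<And>B. \<exists>x. s x > B" and s_bot: "\<And>B. \<exists>x. s x < B"
    and u_top: "\<And>B. \<exists>x>0. u x > B" and u_bot: "\<And>B. \<exists>x<0. u x > B"
begin

lemma s_mono: "strict_mono s"
proof (rule strict_monoI)
  fix x y :: real
  assume "x < y"
  then show "s x < s y"
  proof (rule DERIV_pos_imp_increasing)
    have "1 / (u t)\<^sup>2 > 0" for t
      using u_pos[of t] by simp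
    then show "\<exists>y. (s has_real_derivative y) (at t) \<and> 0 < y" for t
      using s by blast
  qed
qed

lemma u_supersolution: "u \<in> positive_supersolutions (\<lambda>x. 1) c"
proof -
  have "continuous_on UNIV (\<lambda>x. - c x * u x)"
    using u(1) DERIV_continuous_on by (intro continuous_intros c) blast
  note W = classical_W21_loc[OF u this]
  have "AE x in lebesgue. div_op (\<lambda>x. 1) c u x \<le> 0"
    using W(2) by eventually_elim (simp add: div_op_one)
  then show ?thesis
    using W(1) u_pos by (simp add: positive_supersolutions_def positive_fun_def)
qed

text \<open>The quotient \<open>v / u\<close> is positive and concave in \<open>s\<close>, whose
  values are unbounded on both sides. The sign of \<open>k\<close> is recorded because later
  arguments divide by it.\<close>

lemma supersolution_multiple:
  assumes "v \<in> positive_supersolutions (\<lambda>x. 1) c"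
  shows "\<exists>k>0. \<forall>x. v x = k * u x"
proof -
  have v: "v \<in> W21_loc" "\<And>x. v x > 0" "AE x in lebesgue. 1 * div_op (\<lambda>x. 1) c v x \<le> 0"
    using assms by (simp_all add: positive_supersolutions_def positive_fun_def)
  have "weak_supersolution c v"
    using weak_supersolution_if_W21_loc[OF c v(1,3)] by simp
  note conc = weak_supersolution_concave[OF c u u_pos s this]
  have "v x / u x = v 0 / u 0" for x
    using v(2) u_pos by (intro positive_concave_constant[OF conc _ s_mono s_top s_bot]) auto
  then have "v x = v 0 / u 0 * u x" for x
    using u_pos[of x] by (metis less_irrefl nonzero_eq_divide_eq)
  moreover have "v 0 / u 0 > 0"
    using v(2) u_pos by simp
  ultimately show ?thesis by blast
qed

lemma is_critical: "critical (\<lambda>x. 1) c"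
  unfolding critical_def
proof (intro conjI ballI)
  show "positive_supersolutions (\<lambda>x. 1) c \<noteq> {}"
    using u_supersolution by blast
  fix v1 v2
  assume "v1 \<in> positive_supersolutions (\<lambda>x. 1) c" "v2 \<in> positive_supersolutions (\<lambda>x. 1) c"
  then obtain k1 k2 where "k1 > 0" "\<And>x. v1 x = k1 * u x" "\<And>x. v2 x = k2 * u x"
    using supersolution_multiple by metis
  then have "v2 x = k2 / k1 * v1 x" for x by simp
  then show "\<exists>k. \<forall>x. v2 x = k * v1 x" by blast
qed

lemma no_almost_periodic_eigenfunction:
  assumes \<phi>: "\<phi> \<in> W21_loc" "positive_fun \<phi>" "almost_periodic \<phi>"
    and eq: "AE x in lebesgue. - div_op (\<lambda>x. 1) c \<phi> x = lam * \<phi> x"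
  shows False
proof -
  have pos: "\<phi> x > 0" for x
    using \<phi>(2) by (simp add: positive_fun_def)
  obtain B where B: "\<And>x. \<phi> x \<le> B"
    using almost_periodic_bounded_above[OF \<phi>(3)] by blast
  \<comment> \<open>Both signs of \<open>lam\<close> end here: on whichever half-line the lower
    bound holds, \<open>u\<close> exceeds \<open>B / k\<close> somewhere.\<close>
  have contra: False if k: "k > 0" and half_line: "(\<forall>x>0. \<phi> x \<ge> k * u x) \<or> (\<forall>x<0. \<phi> x \<ge> k * u x)" for k
  proof -
    obtain x where "\<phi> x \<ge> k * u x" "u x > B / k"
      using half_line u_top[of "B / k"] u_bot[of "B / k"] by blast
    then show False
      using k B[of x] by (simp add: pos_divide_less_eq mult.commute)
  qed
  show False
  proof (cases "lam \<ge> 0")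
    case True
    have "AE x in lebesgue. div_op (\<lambda>x. 1) c \<phi> x \<le> 0"
      using eq
    proof eventually_elim
      case (elim x)
      have "lam * \<phi> x \<ge> 0" using True pos[of x] by simp
      then show ?case using elim by linarith
    qed
    then have "\<phi> \<in> positive_supersolutions (\<lambda>x. 1) c"
      using \<phi> by (simp add: positive_supersolutions_def)
    then show False
      using supersolution_multiple contra by (metis order_refl)
  next
    case False
    have "AE x in lebesgue. (- 1) * div_op (\<lambda>x. 1) c \<phi> x \<le> 0"
      using eq
    proof eventually_elim
      case (elim x)
      have "lam * \<phi> x \<le> 0" using False pos[of x] by (intro mult_nonpos_nonneg) auto
      then show ?case using elim by linarith
    qed
    \<comment> \<open>For negative \<open>lam\<close>, \<open>\<phi>\<close> is a subsolution;
      concavity for its negative says that \<open>?z\<close> is convex in \<open>s\<close>.\<close>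
    then have "weak_supersolution c (\<lambda>x. (- 1) * \<phi> x)"
      by (rule weak_supersolution_if_W21_loc[OF c \<phi>(1)])
    note conc = weak_supersolution_concave[OF c u u_pos s this]
    let ?z = "\<lambda>x. \<phi> x / u x"
    \<comment> \<open>A convex function cannot lie below its value at 0 at points on both sides of
      0.\<close>
    have half: "(\<forall>x>0. ?z x \<ge> ?z 0) \<or> (\<forall>x<0. ?z x \<ge> ?z 0)"
    proof (rule ccontr)
      assume "\<not> ?thesis"
      then obtain d a where ad: "a < 0" "0 < d" "?z d < ?z 0" "?z a < ?z 0"
        by (auto simp: not_le)
      have "s a < s 0" "s 0 < s d"
        using s_mono ad by (auto dest: strict_monoD)
      then have "(?z 0 - ?z d) * (s 0 - s a) > 0" "(?z 0 - ?z a) * (s d - s 0) > 0"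
        using ad by (auto intro!: mult_pos_pos)
      moreover have "(?z 0 - ?z d) * (s 0 - s a) \<le> (?z a - ?z 0) * (s d - s 0)"
        using conc[OF ad(1,2)] by simp
      moreover have "(?z a - ?z 0) * (s d - s 0) = - ((?z 0 - ?z a) * (s d - s 0))"
        by (simp add: algebra_simps)
      ultimately show False by linarith
    qed
    have "\<phi> x \<ge> ?z 0 * u x" if "?z x \<ge> ?z 0" for x
      using that u_pos[of x] by (simp add: pos_le_divide_eq)
    then have "(\<forall>x>0. \<phi> x \<ge> ?z 0 * u x) \<or> (\<forall>x<0. \<phi> x \<ge> ?z 0 * u x)"
      using half by blast
    then show False
      by (rule contra[rotated]) (use pos u_pos in simp)
  qed
qed

end

section \<open>The limit-periodic example\<close>

definition W :: "real \<Rightarrow> real" where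
  "W x = (\<Sum>n. 1 - cos (x * (1/2) ^ n))"

definition W_deriv :: "real \<Rightarrow> real" where
  "W_deriv x = (\<Sum>n. (1/2) ^ n * sin (x * (1/2) ^ n))"

definition W_deriv2 :: "real \<Rightarrow> real" where
  "W_deriv2 x = (\<Sum>n. (1/4) ^ n * cos (x * (1/2) ^ n))"

text \<open>Termwise differentiation: the differentiated series converges uniformly on the line by
  comparison with a geometric series, and the original one converges at 0, where all its terms
  vanish.\<close>

lemma W_sums: "(\<lambda>n. 1 - cos (x * (1/2) ^ n)) sums W x"
  and W_DERIV: "(W has_real_derivative W_deriv x) (at x)"
proof -
  have "\<exists>g. \<forall>x\<in>UNIV. (\<lambda>n. 1 - cos (x * (1/2) ^ n)) sums g x \<and> (g has_real_derivative W_deriv x) (at x)"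
  proof (rule has_field_derivative_series)
    show "((\<lambda>x. 1 - cos (x * (1/2) ^ n)) has_real_derivative (1/2) ^ n * sin (x * (1/2) ^ n)) (at x)" for n x
      by (auto intro!: derivative_eq_intros)
    show "uniform_limit UNIV (\<lambda>n x. \<Sum>i<n. (1/2) ^ i * sin (x * (1/2) ^ i)) W_deriv sequentially"
      unfolding W_deriv_def[abs_def]
      by (rule Weierstrass_m_test[of _ _ "\<lambda>n. (1/2) ^ n"]) (auto simp: abs_mult)
    show "summable (\<lambda>n. 1 - cos (0 * (1/2) ^ n) :: real)" by simp
  qed auto
  then obtain g where g: "\<And>x. (\<lambda>n. 1 - cos (x * (1/2) ^ n)) sums g x"
    "\<And>x. (g has_real_derivative W_deriv x) (at x)" by auto
  have "W = g"
    using g(1) by (auto simp: W_def sums_iff)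
  then show "(\<lambda>n. 1 - cos (x * (1/2) ^ n)) sums W x" "(W has_real_derivative W_deriv x) (at x)"
    using g by auto
qed

lemma W_deriv_DERIV: "(W_deriv has_real_derivative W_deriv2 x) (at x)"
proof -
  have "\<exists>g. \<forall>x\<in>UNIV. (\<lambda>n. (1/2) ^ n * sin (x * (1/2) ^ n)) sums g x \<and>
      (g has_real_derivative W_deriv2 x) (at x)"
  proof (rule has_field_derivative_series)
    show "((\<lambda>x. (1/2) ^ n * sin (x * (1/2) ^ n)) has_real_derivative (1/4) ^ n * cos (x * (1/2) ^ n)) (at x)" for n x
    proof -
      have "(1/4 :: real) ^ n = (1/2) ^ n * (1/2) ^ n"
        by (simp flip: power_mult_distrib)
      then show ?thesis
        by (auto intro!: derivative_eq_intros)
    qed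
    show "uniform_limit UNIV (\<lambda>n x. \<Sum>i<n. (1/4) ^ i * cos (x * (1/2) ^ i)) W_deriv2 sequentially"
      unfolding W_deriv2_def[abs_def]
      by (rule Weierstrass_m_test[of _ _ "\<lambda>n. (1/4) ^ n"]) (auto simp: abs_mult)
    show "summable (\<lambda>n. (1/2) ^ n * sin (0 * (1/2) ^ n) :: real)" by simp
  qed auto
  then obtain g where g: "\<And>x. (\<lambda>n. (1/2) ^ n * sin (x * (1/2) ^ n)) sums g x"
    "\<And>x. (g has_real_derivative W_deriv2 x) (at x)" by auto
  have "W_deriv = g"
    using g(1) by (auto simp: W_deriv_def sums_iff)
  then show ?thesis using g(2) by simp
qed

lemma continuous_W_deriv2: "continuous_on UNIV W_deriv2"
proof (rule uniform_limit_theorem)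
  show "uniform_limit UNIV (\<lambda>n x. \<Sum>i<n. (1/4) ^ i * cos (x * (1/2) ^ i)) W_deriv2 sequentially"
    unfolding W_deriv2_def[abs_def]
    by (rule Weierstrass_m_test[of _ _ "\<lambda>n. (1/4) ^ n"]) (auto simp: abs_mult)
qed (auto intro!: always_eventually continuous_intros)

section \<open>Values of \<open>W\<close> under repeated doubling\<close>

text \<open>Doubling the argument shifts the series by one index; the added term is the one with
  \<open>n = 0\<close>.\<close>

lemma W_double: "W (2 * x) = W x + (1 - cos (2 * x))"
proof -
  have "(\<lambda>n. 1 - cos (2 * x * (1/2) ^ Suc n)) sums W x"
    using W_sums[of x] by simp
  then have "(\<lambda>n. 1 - cos (2 * x * (1/2) ^ n)) sums (W x + (1 - cos (2 * x * (1/2) ^ 0)))"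
    by (rule sums_Suc)
  then show ?thesis
    using W_sums[of "2 * x"] sums_unique2 by simp
qed

lemma W_minus: "W (- x) = W x"
  by (simp add: W_def)

lemma W_deriv_le: "\<bar>W_deriv x\<bar> \<le> 2"
proof -
  have "\<bar>W_deriv x\<bar> \<le> (\<Sum>n. (1/2) ^ n :: real)"
    unfolding W_deriv_def real_norm_def[symmetric]
    by (rule norm_suminf_le) (auto simp: abs_mult)
  then show ?thesis by (simp add: suminf_geometric)
qed

text \<open>Doubling an angle maps its cosine by \<open>2 * t^2 - 1\<close>, which fixes 1; the
  increment of \<open>W\<close> in \<open>W_double\<close> is then 0.\<close>

lemma W_return: "cos x = 1 \<Longrightarrow> W (2 ^ m * x) = W x \<and> cos (2 ^ m * x) = 1"
proof (induction m)
  case (Suc m)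
  then have "cos (2 * (2 ^ m * x)) = 1"
    unfolding cos_double_cos by simp
  then show ?case
    using Suc W_double[of "2 ^ m * x"] by (simp add: mult.assoc)
qed simp

text \<open>The other fixed point of \<open>2 * t^2 - 1\<close> is \<open>- 1 / 2\<close>, where
  every doubling adds \<open>3 / 2\<close> to \<open>W\<close>.\<close>

lemma W_growth: "cos x = - 1 / 2 \<Longrightarrow> W (2 ^ m * x) = W x + 3 / 2 * m \<and> cos (2 ^ m * x) = - 1 / 2"
proof (induction m)
  case (Suc m)
  then have "cos (2 * (2 ^ m * x)) = - 1 / 2"
    unfolding cos_double_cos by (simp add: power2_eq_square)
  then show ?case
    using Suc W_double[of "2 ^ m * x"] by (simp add: mult.assoc algebra_simps)
qed simp

lemma W_nonneg: "W x \<ge> 0"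
  unfolding W_def by (rule suminf_nonneg) (use W_sums in \<open>auto simp: sums_iff\<close>)

lemma exp_W_unbounded: "\<exists>x>0. exp (W x) > B"
proof -
  obtain m :: nat where m: "B < real m"
    using reals_Archimedean2 by blast
  have "cos (2 * (pi / 3)) = - 1 / 2"
    unfolding cos_double_cos cos_60 by (simp add: power2_eq_square)
  then have "W (2 ^ m * (2 * (pi / 3))) = W (2 * (pi / 3)) + 3 / 2 * m"
    using W_growth by blast
  then have "real m \<le> W (2 ^ m * (2 * (pi / 3)))"
    using W_nonneg[of "2 * (pi / 3)"] by simp
  also have "\<dots> < exp (W (2 ^ m * (2 * (pi / 3))))"
    using exp_ge_add_one_self[of "W (2 ^ m * (2 * (pi / 3)))"] by linarith
  finally have "exp (W (2 ^ m * (2 * (pi / 3)))) > B"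
    using m by linarith
  moreover have "2 ^ m * (2 * (pi / 3)) > 0" by simp
  ultimately show ?thesis by blast
qed

text \<open>At the points \<open>X m\<close> the value of \<open>W\<close> is always
  \<open>W (2 * pi)\<close>. As \<open>W_deriv\<close> is at most 2, \<open>W\<close> exceeds this
  by at most 2 on the following unit interval, so \<open>s\<close> gains at least
  \<open>\<kappa>\<close> on each of these intervals.\<close>

lemma antiderivative_unbounded:
  fixes s :: "real \<Rightarrow> real"
  assumes s: "\<And>x. (s has_real_derivative 1 / (exp (W x))\<^sup>2) (at x)"
  shows "\<exists>x. s x > B"
proof -
  define X where "X = (\<lambda>m::nat. 2 ^ m * (2 * pi))"
  define \<kappa> where "\<kappa> = 1 / (exp (W (2 * pi) + 2))\<^sup>2"
  have \<kappa>: "\<kappa> > 0" by (simp add: \<kappa>_def)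
  have mono: "s x \<le> s y" if "x \<le> y" for x y
  proof (rule DERIV_nonneg_imp_nondecreasing[OF that])
    show "\<exists>y. (s has_real_derivative y) (at t) \<and> 0 \<le> y" for t
      using s[of t] by fastforce
  qed
  have step: "s (X m + 1) - s (X m) \<ge> \<kappa>" for m
  proof -
    obtain t where t: "X m < t" "t < X m + 1"
      "s (X m + 1) - s (X m) = (X m + 1 - X m) * (1 / (exp (W t))\<^sup>2)"
      using MVT2[of "X m" "X m + 1" s "\<lambda>t. 1 / (exp (W t))\<^sup>2"] s by auto
    obtain r where r: "W t - W (X m) = (t - X m) * W_deriv r"
      using MVT2[of "X m" t W] W_DERIV t(1) by auto
    have "(t - X m) * W_deriv r \<le> 1 * 2"
      using t W_deriv_le[of r] by (intro order_trans[OF mult_left_mono mult_right_mono]) (auto simp: abs_le_iff)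
    moreover have "W (X m) = W (2 * pi)"
      unfolding X_def using W_return[of "2 * pi" m] by simp
    ultimately have "W t \<le> W (2 * pi) + 2"
      using r by simp
    then have "(exp (W t))\<^sup>2 \<le> (exp (W (2 * pi) + 2))\<^sup>2"
      by (intro power_mono) auto
    then have "\<kappa> \<le> 1 / (exp (W t))\<^sup>2"
      unfolding \<kappa>_def by (intro divide_left_mono) auto
    then show ?thesis using t(3) by simp
  qed
  have "s (X m) \<ge> s (X 0) + real m * \<kappa>" for m
  proof (induction m)
    case (Suc m)
    \<comment> \<open>The gap from \<open>X m\<close> to its double is at least
      \<open>2 * pi\<close>, so the unit intervals do not overlap and their gains add up.\<close>
    have "X m \<ge> 1 * (2 * pi)"
      unfolding X_def by (intro mult_right_mono) auto
    moreover have "X (Suc m) = 2 * X m"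
      by (simp add: X_def)
    ultimately have "X m + 1 \<le> X (Suc m)"
      using pi_ge_two by simp
    then have "s (X m + 1) \<le> s (X (Suc m))"
      by (rule mono)
    then show ?case
      using Suc step[of m] by (simp add: algebra_simps)
  qed simp
  moreover obtain m :: nat where "(B - s (X 0)) / \<kappa> < real m"
    using reals_Archimedean2 by blast
  then have "B < s (X 0) + real m * \<kappa>"
    using \<kappa> by (simp add: pos_divide_less_eq algebra_simps)
  ultimately show ?thesis
    by (meson less_le_trans)
qed

definition potential :: "real \<Rightarrow> real" where
  "potential x = - (W_deriv2 x + (W_deriv x)\<^sup>2)"

lemma continuous_potential: "continuous_on UNIV potential"
proof -
  have "continuous_on UNIV W_deriv"
    using W_deriv_DERIV DERIV_continuous_on by blast
  then show ?thesis
    unfolding potential_def[abs_def] by (intro continuous_intros continuous_W_deriv2)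
qed

lemma exp_W_ground_state:
  obtains s where "ground_state potential (\<lambda>x. exp (W x)) (\<lambda>x. W_deriv x * exp (W x)) s"
proof -
  have "continuous_on UNIV W"
    using W_DERIV DERIV_continuous_on by blast
  then have "isCont (\<lambda>x. 1 / (exp (W x))\<^sup>2) x" for x
    by (intro continuous_intros) (auto simp: continuous_on_eq_continuous_at)
  then have "\<exists>F. \<forall>x. - \<infinity> < ereal x \<longrightarrow> ereal x < \<infinity> \<longrightarrow>
      (F has_vector_derivative 1 / (exp (W x))\<^sup>2) (at x)"
    by (intro einterval_antiderivative) auto
  then obtain s where s: "\<And>x. (s has_real_derivative 1 / (exp (W x))\<^sup>2) (at x)"
    by (auto simp: has_real_derivative_iff_has_vector_derivative)
  \<comment> \<open>As \<open>W\<close> is even, the reflected function is again an antiderivative;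
    its unboundedness above is that of \<open>s\<close> below.\<close>
  have s': "((\<lambda>x. - s (- x)) has_real_derivative 1 / (exp (W x))\<^sup>2) (at x)" for x
  proof -
    have "((\<lambda>x. s (- x)) has_real_derivative 1 / (exp (W (- x)))\<^sup>2 * (- 1)) (at x)"
      by (rule DERIV_chain2[OF s]) (auto intro!: derivative_eq_intros)
    from DERIV_minus[OF this] show ?thesis
      by (simp add: W_minus)
  qed
  show ?thesis
  proof
    show "ground_state potential (\<lambda>x. exp (W x)) (\<lambda>x. W_deriv x * exp (W x)) s"
    proof
      show "((\<lambda>x. exp (W x)) has_real_derivative W_deriv x * exp (W x)) (at x)" for x
        by (auto intro!: derivative_eq_intros W_DERIV)
      show "((\<lambda>x. W_deriv x * exp (W x)) has_real_derivative - potential x * exp (W x)) (at x)" for x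
        by (auto intro!: derivative_eq_intros W_DERIV W_deriv_DERIV
            simp: potential_def power2_eq_square algebra_simps)
      show "\<exists>x. s x > B" for B
        using s by (rule antiderivative_unbounded)
      show "\<exists>x. s x < B" for B
        using antiderivative_unbounded[OF s', of "- B"] by (metis neg_less_iff_less)
      show "\<exists>x>0. exp (W x) > B" for B
        by (rule exp_W_unbounded)
      show "\<exists>x<0. exp (W x) > B" for B
        using exp_W_unbounded[of B] W_minus by (metis neg_less_0_iff_less)
    qed (use s continuous_potential in auto)
  qed
qed

text \<open>A translation by \<open>y\<close> acts on the series for \<open>W_deriv\<close> and \<open>W_deriv2\<close> through the phases
  \<open>\<theta> n = cis (y / 2^n)\<close> only, and these range over a compact product of circles.\<close>

definition exp_series :: "real \<Rightarrow> (nat \<Rightarrow> complex) \<Rightarrow> real \<Rightarrow> complex" where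
  "exp_series q \<theta> x = (\<Sum>n. of_real (q ^ n) * cis (x * (1/2) ^ n) * \<theta> n)"

section \<open>Almost periodicity of the potential\<close>

lemma exp_series_summable:
  assumes q: "0 \<le> q" "q < 1" and "\<And>n. norm (\<theta> n) \<le> 1"
  shows "summable (\<lambda>n. of_real (q ^ n) * cis (x * (1/2) ^ n) * \<theta> n)"
proof (rule summable_comparison_test'[of "\<lambda>n. q ^ n" 0])
  show "summable (\<lambda>n. q ^ n)" using q by simp
  show "norm (of_real (q ^ n) * cis (x * (1/2) ^ n) * \<theta> n) \<le> q ^ n" for n
    using assms by (simp add: norm_mult norm_power mult_left_le)
qed

lemma exp_series_bounded:
  assumes q: "0 \<le> q" "q < 1" and "\<And>n. norm (\<theta> n) \<le> 1"
  shows "norm (exp_series q \<theta> x) \<le> 1 / (1 - q)"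
proof -
  have "norm (exp_series q \<theta> x) \<le> (\<Sum>n. q ^ n)"
    unfolding exp_series_def
  proof (rule norm_suminf_le)
    show "norm (of_real (q ^ n) * cis (x * (1/2) ^ n) * \<theta> n) \<le> q ^ n" for n
      using assms by (simp add: norm_mult norm_power mult_left_le)
  qed (use q in simp)
  then show ?thesis using q by (simp add: suminf_geometric)
qed

text \<open>The difference of the two series is bounded, independently of \<open>x\<close>, by the
  sum of \<open>q ^ n * norm (\<theta> k n - l n)\<close>. This tends to 0 by dominated convergence
  for series, with majorant \<open>2 * q ^ n\<close>.\<close>

lemma uniform_limit_exp_series:
  assumes q: "0 \<le> q" "q < 1" and \<theta>: "\<And>k n. norm (\<theta> k n) \<le> 1" and l: "\<And>n. norm (l n) \<le> 1"
    and lim: "\<And>n. (\<lambda>k. \<theta> k n) \<longlonglongrightarrow> l n"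
  shows "uniform_limit UNIV (\<lambda>k. exp_series q (\<theta> k)) (exp_series q l) sequentially"
proof -
  let ?a = "\<lambda>n k. q ^ n * norm (\<theta> k n - l n)"
  have b: "\<bar>?a n k\<bar> \<le> 2 * q ^ n" for n k
  proof -
    have "norm (\<theta> k n - l n) \<le> 2"
      using norm_triangle_ineq4[of "\<theta> k n" "l n"] \<theta>[of k n] l[of n] by linarith
    then have "q ^ n * norm (\<theta> k n - l n) \<le> q ^ n * 2"
      using q by (intro mult_left_mono) auto
    then show ?thesis using q by simp
  qed
  have sq: "summable (\<lambda>n. 2 * q ^ n)" using q by (intro summable_mult summable_geometric) simp
  have sa: "summable (\<lambda>n. ?a n k)" for k
    by (rule summable_comparison_test'[OF sq, of 0]) (use b in auto)
  have "(\<lambda>k. \<Sum>n. ?a n k) \<longlonglongrightarrow> (\<Sum>n. 0)"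
  proof (rule tannerys_theorem[of ?a, THEN conjunct2, THEN conjunct2])
    show "(\<lambda>k. ?a n k) \<longlonglongrightarrow> 0" for n
      using tendsto_mult_left[OF tendsto_norm[OF LIM_zero[OF lim[of n]]], of "q ^ n"] by simp
    show "\<forall>\<^sub>F (n, k) in sequentially \<times>\<^sub>F sequentially. norm (?a n k) \<le> 2 * q ^ n"
      using b by (intro always_eventually) auto
  qed (use sq in auto)
  then have T: "(\<lambda>k. \<Sum>n. ?a n k) \<longlonglongrightarrow> 0" by simp
  have diff: "dist (exp_series q (\<theta> k) x) (exp_series q l x) \<le> (\<Sum>n. ?a n k)" for k x
  proof -
    have "exp_series q (\<theta> k) x - exp_series q l x =
        (\<Sum>n. of_real (q ^ n) * cis (x * (1/2) ^ n) * (\<theta> k n - l n))"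
      unfolding exp_series_def
      by (subst suminf_diff[OF exp_series_summable[OF q \<theta>] exp_series_summable[OF q l]])
        (simp add: right_diff_distrib)
    also have "norm \<dots> \<le> (\<Sum>n. ?a n k)"
      by (rule norm_suminf_le[OF _ sa]) (use q in \<open>simp add: norm_mult norm_power\<close>)
    finally show ?thesis by (simp add: dist_norm)
  qed
  show ?thesis
  proof (rule uniform_limitI)
    fix e :: real
    assume "e > 0"
    with T have "\<forall>\<^sub>F k in sequentially. (\<Sum>n. ?a n k) < e"
      by (rule order_tendstoD)
    then show "\<forall>\<^sub>F k in sequentially. \<forall>x\<in>UNIV. dist (exp_series q (\<theta> k) x) (exp_series q l x) < e"
      by eventually_elim (use diff le_less_trans in blast)
  qed
qed

lemma W_deriv_shift: "W_deriv (x + y) = Im (exp_series (1/2) (\<lambda>n. cis (y * (1/2) ^ n)) x)"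
  and W_deriv2_shift: "W_deriv2 (x + y) = Re (exp_series (1/4) (\<lambda>n. cis (y * (1/2) ^ n)) x)"
proof -
  have e: "of_real (q ^ n) * cis (x * (1/2) ^ n) * cis (y * (1/2) ^ n) =
      of_real (q ^ n) * cis ((x + y) * (1/2) ^ n)" for q n
    by (simp add: cis_mult distrib_right mult.assoc)
  have S: "(\<lambda>n. of_real (q ^ n) * cis ((x + y) * (1/2) ^ n)) sums exp_series q (\<lambda>n. cis (y * (1/2) ^ n)) x"
    if "0 \<le> q" "q < 1" for q
    using exp_series_summable[OF that, of "\<lambda>n. cis (y * (1/2) ^ n)" x]
    unfolding exp_series_def e by (simp add: summable_sums)
  show "W_deriv (x + y) = Im (exp_series (1/2) (\<lambda>n. cis (y * (1/2) ^ n)) x)"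
    using bounded_linear.sums[OF bounded_linear_Im S, of "1/2"]
    unfolding W_deriv_def by (simp del: of_real_power add: sums_iff)
  show "W_deriv2 (x + y) = Re (exp_series (1/4) (\<lambda>n. cis (y * (1/2) ^ n)) x)"
    using bounded_linear.sums[OF bounded_linear_Re S, of "1/4"]
    unfolding W_deriv2_def by (simp del: of_real_power add: sums_iff)
qed

text \<open>Once all phases converge along one subsequence, the translates of \<open>W_deriv\<close>
  and \<open>W_deriv2\<close> converge uniformly, hence so does their combination in
  \<open>potential\<close>.\<close>

lemma almost_periodic_potential: "almost_periodic potential"
  unfolding almost_periodic_def
proof
  fix X :: "nat \<Rightarrow> real"
  \<comment> \<open>A diagonal argument extracts one subsequence that works for all the countably
    many phases, each bounded by 1.\<close>
  obtain r where r: "strict_mono (r :: nat \<Rightarrow> nat)"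
    and conv: "\<And>n::nat. n \<in> UNIV \<Longrightarrow> \<exists>l. (\<lambda>k. cis (X (r k) * (1/2) ^ n)) \<longlonglongrightarrow> l"
    by (rule function_convergent_subsequence[of UNIV "\<lambda>k n. cis (X k * (1/2) ^ n)" 1]) auto
  define l where "l n = lim (\<lambda>k. cis (X (r k) * (1/2) ^ n))" for n
  have lim: "(\<lambda>k. cis (X (r k) * (1/2) ^ n)) \<longlonglongrightarrow> l n" for n
    using conv[of n] unfolding l_def by (metis UNIV_I convergentI convergent_LIMSEQ_iff)
  have l: "norm (l n) \<le> 1" for n
    using tendsto_norm[OF lim[of n]] by (simp add: LIMSEQ_const_iff)
  have u: "uniform_limit UNIV (\<lambda>k. exp_series q (\<lambda>n. cis (X (r k) * (1/2) ^ n))) (exp_series q l) sequentially"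
    if "0 \<le> q" "q < 1" for q
    using that lim l by (intro uniform_limit_exp_series) auto
  have u1: "uniform_limit UNIV (\<lambda>k x. W_deriv (x + X (r k))) (\<lambda>x. Im (exp_series (1/2) l x)) sequentially"
    unfolding W_deriv_shift by (intro bounded_linear_uniform_limit_intros u) auto
  have u2: "uniform_limit UNIV (\<lambda>k x. W_deriv2 (x + X (r k))) (\<lambda>x. Re (exp_series (1/4) l x)) sequentially"
    unfolding W_deriv2_shift by (intro bounded_linear_uniform_limit_intros u) auto
  \<comment> \<open>Boundedness of the limit lets uniform convergence pass to the square of
    \<open>W_deriv\<close>.\<close>
  have b: "bounded (range (\<lambda>x. Im (exp_series (1/2) l x)))"
  proof (rule boundedI)
    fix y
    assume "y \<in> range (\<lambda>x. Im (exp_series (1/2) l x))"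
    then obtain x where "y = Im (exp_series (1/2) l x)" by blast
    moreover have "norm (exp_series (1/2) l x) \<le> 1 / (1 - 1/2)"
      by (rule exp_series_bounded) (use l in auto)
    ultimately show "norm y \<le> 2"
      using abs_Im_le_cmod[of "exp_series (1/2) l x"] by simp
  qed
  have "uniform_limit UNIV (\<lambda>k x. - (W_deriv2 (x + X (r k)) + W_deriv (x + X (r k)) * W_deriv (x + X (r k))))
      (\<lambda>x. - (Re (exp_series (1/4) l x) + Im (exp_series (1/2) l x) * Im (exp_series (1/2) l x))) sequentially"
    by (intro uniform_limit_uminus uniform_limit_add u1 u2 uniform_lim_mult b)
  then have "uniform_limit UNIV (\<lambda>k x. potential (x + X (r k)))
      (\<lambda>x. - (Re (exp_series (1/4) l x) + Im (exp_series (1/2) l x) * Im (exp_series (1/2) l x))) sequentially"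
    by (simp add: potential_def power2_eq_square)
  then show "\<exists>r g. strict_mono (r :: nat \<Rightarrow> nat) \<and> uniform_limit UNIV (\<lambda>k x. potential (x + X (r k))) g sequentially"
    using r by blast
qed

lemma bounded_potential: "bounded (range potential)"
proof (rule boundedI)
  fix y
  assume "y \<in> range potential"
  then obtain x where y: "y = potential x" by blast
  have "norm (W_deriv2 x) \<le> (\<Sum>n. (1/4) ^ n :: real)"
    unfolding W_deriv2_def by (rule norm_suminf_le) (auto simp: abs_mult)
  then have "\<bar>W_deriv2 x\<bar> \<le> 4 / 3" by (simp add: suminf_geometric)
  moreover have "(W_deriv x)\<^sup>2 \<le> 2\<^sup>2"
    using W_deriv_le[of x] by (metis abs_ge_zero power2_abs power_mono)
  then have "\<bar>(W_deriv x)\<^sup>2\<bar> \<le> 4" by simp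
  ultimately show "norm y \<le> 6"
    unfolding y potential_def real_norm_def by linarith
qed

lemma almost_periodic_const: "almost_periodic (\<lambda>x. k)"
  unfolding almost_periodic_def
  by (auto intro!: exI[of _ id] exI[of _ "\<lambda>x. k"] simp: strict_mono_def uniform_limit_const)

theorem mainTheorem3:
  shows "\<exists>A c :: real \<Rightarrow> real.
     A \<in> borel_measurable lebesgue \<and> c \<in> borel_measurable lebesgue \<and>
     bounded (range A) \<and> bounded (range c) \<and>
     smooth A \<and> (INF x. A x) > 0 \<and>
     almost_periodic A \<and> almost_periodic c \<and>
     critical A c \<and>
     \<not> (\<exists>(lam :: real) \<phi>. \<phi> \<in> W21_loc \<and> positive_fun \<phi> \<and> almost_periodic \<phi> \<and>
          (AE x in lebesgue. - div_op A c \<phi> x = lam * \<phi> x))"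
proof -
  obtain s where "ground_state potential (\<lambda>x. exp (W x)) (\<lambda>x. W_deriv x * exp (W x)) s"
    using exp_W_ground_state by blast
  then interpret ground_state potential "\<lambda>x. exp (W x)" "\<lambda>x. W_deriv x * exp (W x)" s .
  have "potential \<in> borel_measurable borel"
    using continuous_potential by (rule borel_measurable_continuous_onI)
  then have "potential \<in> borel_measurable lebesgue"
    by (intro measurable_completion) simp
  then show ?thesis
    using smooth_const almost_periodic_const bounded_potential almost_periodic_potential is_critical
      no_almost_periodic_eigenfunction
    by (intro exI[of _ "\<lambda>x. 1"] exI[of _ potential] conjI) auto
qed

end
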